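(* Let $Q\not\equiv 0$ and $R\not\equiv 0$ be rational functions, let $\alpha$ be a polynomial, and let $k\geq 1$ and $m\geq 2$ be integers. Then the differential equation $$f^m+\big(Rf^{(k)}\big)^m=Qe^{\alpha}$$ has no meromorphic solution $f$ on $\mathbb{C}$ of infinite order.
   Context: The order of a meromorphic function $f$ is $\rho(f)=\limsup_{r\to\infty}\frac{\log T(r,f)}{\log r}$, where $T(r,f)$ is the Nevanlinna characteristic function. *)

theory Defs
  imports "HOL-Complex_Analysis.Complex_Analysis" "HOL-Computational_Algebra.Polynomial"
begin

definition log_plus :: "real \<Rightarrow> real" where
  "log_plus x = (if x \<le> 1 then 0 else ln x)"

definition pole_count :: "(complex \<Rightarrow> complex) \<Rightarrow> real \<Rightarrow> real" where
  "pole_count f r = (\<Sum>z\<in>{z. cmod z \<le> r \<and> is_pole f z}. real (nat (- zorder f z)))"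

definition nev_N :: "(complex \<Rightarrow> complex) \<Rightarrow> real \<Rightarrow> real" where
  "nev_N f r = integral {0..r} (\<lambda>t. (pole_count f t - pole_count f 0) / t)
               + pole_count f 0 * ln r"

definition nev_m :: "(complex \<Rightarrow> complex) \<Rightarrow> real \<Rightarrow> real" where
  "nev_m f r = (1 / (2 * pi)) *
     integral {0..2*pi} (\<lambda>\<theta>. log_plus (cmod (f (complex_of_real r * exp (\<i> * complex_of_real \<theta>)))))"

definition nev_T :: "(complex \<Rightarrow> complex) \<Rightarrow> real \<Rightarrow> real" where
  "nev_T f r = nev_m f r + nev_N f r"

definition mero_order :: "(complex \<Rightarrow> complex) \<Rightarrow> ereal" where
  "mero_order f = Limsup at_top (\<lambda>r::real. ereal (ln (nev_T f r) / ln r))"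

definition rational_function :: "(complex \<Rightarrow> complex) \<Rightarrow> bool" where
  "rational_function R \<longleftrightarrow> (\<exists>p q. q \<noteq> 0 \<and> (\<forall>z. R z = poly p z / poly q z))"

end

theory Submission
  imports Defs "HOL-Computational_Algebra.Fundamental_Theorem_Algebra"
begin

text \<open>
  Put \<open>h = R f\<^bsup>(k)\<^esup>\<close> and \<open>u\<^sub>w = f - w h\<close> for the \<open>m\<close> roots \<open>w\<close> of \<open>w\<^sup>m = -1\<close>. Then
  \<open>f\<^sup>m + h\<^sup>m\<close> is the product of the \<open>u\<^sub>w\<close>. Outside a large disc \<open>f\<close> has no poles, because differentiation
  raises the pole order, and the \<open>u\<^sub>w\<close> have no zeros. Their logarithmic derivatives \<open>\<phi>\<^sub>w = u\<^sub>w'/u\<^sub>w\<close>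
  sum to the rational function \<open>(Q e\<^sup>\<alpha>)'/(Q e\<^sup>\<alpha>)\<close>.

  The \<open>\<phi>\<^sub>w\<close> grow at most polynomially. Otherwise, a point-selection argument gives points \<open>z\<close>
  at which \<open>M = max\<^sub>w |\<phi>\<^sub>w(z)|\<close> is much larger than any fixed power of \<open>|z|\<close>, while the \<open>\<phi>\<^sub>w\<close> are nearly
  constant on the disc of radius \<open>1/M\<close> about \<open>z\<close>. There \<open>u\<^sub>w\<close> is close to an exponential, so
  \<open>u\<^sub>w\<^bsup>(k)\<^esup>\<close> is about \<open>\<phi>\<^sub>w(z)\<^sup>k u\<^sub>w\<close>, whereas \<open>f\<^bsup>(k)\<^esup> = h/R\<close> is negligible at the scale \<open>M\<^sup>k\<close>.
  Linear algebra excludes this. Integrating \<open>\<phi>\<^sub>w\<close> along rays gives \<open>|f(z)| \<le> exp(C |z|\<^sup>N)\<close> for large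
  \<open>|z|\<close>, and as \<open>f\<close> has finitely many poles its order is finite.
\<close>

subsection \<open>Local estimates\<close>

text \<open>Gronwall's inequality along the segment: the weighted square \<open>F t\<close> has
  nonpositive derivative. Working with the square of the norm avoids a branch of the logarithm and
  is smooth even at zeros of \<open>u\<close>.\<close>

lemma norm_le_exp_of_log_deriv_bound:
  fixes u \<phi> :: "complex \<Rightarrow> complex"
  assumes deriv: "\<And>x. x \<in> closed_segment z w \<Longrightarrow> (u has_field_derivative \<phi> x * u x) (at x)"
    and bound: "\<And>x. x \<in> closed_segment z w \<Longrightarrow> norm (\<phi> x) \<le> B"
  shows "norm (u w) \<le> norm (u z) * exp (B * dist z w)"
proof -
  define c where "c = B * dist z w"
  define g where "g t = z + of_real t * (w - z)" for t :: real
  define F where "F t = exp (- 2 * c * t) * (u (g t) \<bullet> u (g t))" for t :: real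
  have seg: "g t \<in> closed_segment z w" if "0 \<le> t" "t \<le> 1" for t
    unfolding g_def closed_segment_def using that
    by (auto simp: algebra_simps scaleR_conv_of_real intro!: exI[of _ t])
  have "F 1 \<le> F 0"
  proof (rule DERIV_nonpos_imp_nonincreasing[of 0 1 F])
    fix t :: real assume t: "0 \<le> t" "t \<le> 1"
    define D where "D = (w - z) * (\<phi> (g t) * u (g t))"
    have "(g has_vector_derivative (w - z)) (at t)"
      unfolding g_def by (auto intro!: derivative_eq_intros simp: has_vector_derivative_def scaleR_conv_of_real)
    then have U: "((u \<circ> g) has_vector_derivative D) (at t)"
      unfolding D_def using deriv[OF seg[OF t]]
      by (intro field_vector_diff_chain_at)
    then have U': "((\<lambda>x. u (g x)) has_derivative (\<lambda>x. x *\<^sub>R D)) (at t)"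
      by (simp add: has_vector_derivative_def o_def)
    have "(F has_derivative (\<lambda>x. x * (exp (- 2 * c * t) * (2 * (u (g t) \<bullet> D) - 2 * c * (u (g t) \<bullet> u (g t)))))) (at t)"
      unfolding F_def
      by (rule derivative_eq_intros U' refl | simp add: algebra_simps inner_commute)+
    then have "(F has_real_derivative exp (- 2 * c * t) * (2 * (u (g t) \<bullet> D) - 2 * c * (u (g t) \<bullet> u (g t)))) (at t)"
      by (simp add: has_field_derivative_def mult.commute[of _ "exp (- 2 * c * t) * _"] mult_commute_abs)
    moreover have "u (g t) \<bullet> D \<le> c * (u (g t) \<bullet> u (g t))"
    proof -
      have "u (g t) \<bullet> D \<le> norm (u (g t)) * norm D"
        by (rule norm_cauchy_schwarz)
      also have "\<dots> = norm (\<phi> (g t)) * dist z w * (norm (u (g t)))\<^sup>2"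
        by (simp add: D_def norm_mult dist_norm norm_minus_commute power2_eq_square)
      also have "\<dots> \<le> B * dist z w * (norm (u (g t)))\<^sup>2"
        by (intro mult_right_mono bound seg t) auto
      finally show ?thesis
        by (simp add: c_def power2_norm_eq_inner)
    qed
    ultimately show "\<exists>y. (F has_real_derivative y) (at t) \<and> y \<le> 0"
      by (intro exI conjI) (auto simp: mult_le_0_iff)
  qed auto
  then have "exp (- 2 * c) * (norm (u w))\<^sup>2 \<le> (norm (u z))\<^sup>2"
    by (simp add: F_def g_def power2_norm_eq_inner)
  then have "(norm (u w))\<^sup>2 \<le> (norm (u z) * exp c)\<^sup>2"
    by (simp add: power_mult_distrib exp_minus field_simps flip: exp_of_nat_mult)
  then show ?thesis
    unfolding c_def by (rule power2_le_imp_le) auto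
qed

text \<open>The defect \<open>D = u' - a u\<close> equals \<open>(\<phi> - a) u\<close>, so it is
  small on the disc of radius \<open>1/M\<close>, where \<open>norm u\<close> exceeds its value at
  \<open>z\<close> by at most the factor \<open>exp B\<close>. Cauchy's inequality bounds the
  derivatives of \<open>D\<close> at \<open>z\<close>, and the recursion
  \<open>u^(n+1) - a^(n+1) u = D^(n) + a (u^(n) - a^n u)\<close> accumulates these errors.\<close>

lemma higher_deriv_approx_exp:
  fixes u \<phi> :: "complex \<Rightarrow> complex"
  assumes "open A" "cball z (1 / M) \<subseteq> A" "u holomorphic_on A" "M > 0"
    and du: "\<And>x. x \<in> cball z (1 / M) \<Longrightarrow> deriv u x = \<phi> x * u x"
    and bound: "\<And>x. x \<in> cball z (1 / M) \<Longrightarrow> norm (\<phi> x) \<le> B * M"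
    and close: "\<And>x. x \<in> cball z (1 / M) \<Longrightarrow> norm (\<phi> x - a) \<le> \<eta> * M"
    and a: "norm a \<le> M"
  shows "norm ((deriv ^^ n) u z - a ^ n * u z) \<le> n * fact n * (\<eta> * exp B) * M ^ n * norm (u z)"
proof (induction n)
  case 0
  then show ?case by simp
next
  case (Suc n)
  define D where "D x = deriv u x - a * u x" for x
  define G where "G = \<eta> * exp B"
  have "0 \<le> \<eta> * M"
    using close[of z] assms(4) by (meson centre_in_cball divide_nonneg_pos dual_order.trans less_eq_real_def norm_ge_zero zero_le_one)
  then have \<eta>: "\<eta> \<ge> 0" "G \<ge> 0"
    using \<open>M > 0\<close> by (auto simp: zero_le_mult_iff G_def)
  have z: "z \<in> A"
    using assms(2,4) by (auto simp: subset_iff)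
  have holD: "D holomorphic_on A"
    unfolding D_def using assms(1,3) by (auto intro!: holomorphic_intros)
  have growth: "norm (u x) \<le> norm (u z) * exp B" if x: "x \<in> cball z (1 / M)" for x
  proof -
    have seg: "closed_segment z x \<subseteq> cball z (1 / M)"
      using x \<open>M > 0\<close> by (intro closed_segment_subset) auto
    have "B \<ge> 0"
      using norm_ge_zero[of "\<phi> x"] bound[OF x] \<open>M > 0\<close>
      by (smt (verit) mult_less_0_iff)
    have "norm (u x) \<le> norm (u z) * exp (B * M * dist z x)"
    proof (rule norm_le_exp_of_log_deriv_bound)
      fix y assume "y \<in> closed_segment z x"
      then have y: "y \<in> cball z (1 / M)"
        using seg by auto
      then show "(u has_field_derivative \<phi> y * u y) (at y)"
        using du[OF y] assms(1-3) by (metis holomorphic_derivI subsetD)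
      show "norm (\<phi> y) \<le> B * M"
        by (rule bound[OF y])
    qed
    also have "\<dots> \<le> norm (u z) * exp (B * 1)"
      using x \<open>M > 0\<close> \<open>B \<ge> 0\<close> unfolding mult.assoc
      by (intro mult_left_mono iffD2[OF exp_le_cancel_iff]) (auto simp: field_simps)
    finally show ?thesis by simp
  qed
  have "norm ((deriv ^^ n) D z) \<le> fact n * (\<eta> * M * (norm (u z) * exp B)) / (1 / M) ^ n"
  proof (rule Cauchy_inequality)
    show "D holomorphic_on ball z (1 / M)"
      using holD assms(2) by (rule holomorphic_on_subset[OF _ subset_trans[OF ball_subset_cball]])
    show "continuous_on (cball z (1 / M)) D"
      using holD assms(2) by (meson holomorphic_on_imp_continuous_on holomorphic_on_subset)
    show "norm (D x) \<le> \<eta> * M * (norm (u z) * exp B)" if "norm (z - x) = 1 / M" for x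
    proof -
      have x: "x \<in> cball z (1 / M)"
        using that by (auto simp: dist_norm)
      have "D x = (\<phi> x - a) * u x"
        by (simp add: D_def du[OF x] algebra_simps)
      then show ?thesis
        using close[OF x] growth[OF x] \<open>0 \<le> \<eta> * M\<close> by (simp add: norm_mult mult_mono)
    qed
  qed (use \<open>M > 0\<close> in auto)
  then have D: "norm ((deriv ^^ n) D z) \<le> fact n * G * M ^ Suc n * norm (u z)"
    using \<open>M > 0\<close> by (simp add: field_simps G_def)
  have "(deriv ^^ n) D z = (deriv ^^ n) (deriv u) z - (deriv ^^ n) (\<lambda>x. a * u x) z"
    unfolding D_def using assms(1,3) z
    by (intro higher_deriv_diff) (auto intro!: holomorphic_intros)
  also have "(deriv ^^ n) (\<lambda>x. a * u x) z = a * (deriv ^^ n) u z"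
    using assms(1,3) z by (intro higher_deriv_cmult) auto
  finally have "(deriv ^^ Suc n) u z - a ^ Suc n * u z
      = (deriv ^^ n) D z + a * ((deriv ^^ n) u z - a ^ n * u z)"
    by (simp add: funpow_Suc_right algebra_simps del: funpow.simps)
  also have "norm \<dots> \<le> norm ((deriv ^^ n) D z) + norm a * norm ((deriv ^^ n) u z - a ^ n * u z)"
    by (metis norm_mult norm_triangle_ineq)
  also have "\<dots> \<le> fact n * G * M ^ Suc n * norm (u z) + M * (n * fact n * G * M ^ n * norm (u z))"
    using D Suc.IH a \<open>M > 0\<close> by (intro add_mono mult_mono) (auto simp: G_def)
  also have "\<dots> = (n + 1) * fact n * (G * M ^ Suc n * norm (u z))"
    by (simp add: algebra_simps)
  \<comment> \<open>The recursion produces the sum of \<open>fact j\<close> over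
    \<open>j < n\<close>; \<open>n * fact n\<close> is a convenient majorant.\<close>
  also have "\<dots> \<le> Suc n * fact (Suc n) * (G * M ^ Suc n * norm (u z))"
    using \<eta> \<open>M > 0\<close> by (intro mult_right_mono mult_mono fact_mono) auto
  finally show ?case
    by (simp only: G_def mult.assoc of_nat_mult of_nat_fact)
qed

text \<open>Point selection as in Zalcman's rescaling: \<open>z\<close> maximizes
  \<open>g x * (1 - dist z0 x)\<close>. With \<open>e\<close> half the distance from
  \<open>z\<close> to the unit sphere about \<open>z0\<close>, the weight on
  \<open>cball z e\<close> is at least half its value at \<open>z\<close>, which gives the doubling
  bound. Comparison with \<open>z0\<close>, where the weight is 1, shows that \<open>e\<close> is
  large on the scale \<open>1 / g z\<close> when \<open>g z0\<close> is large.\<close>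

lemma doubling_point:
  fixes g :: "'a::euclidean_space \<Rightarrow> real"
  assumes "continuous_on (cball z0 1) g" "g z0 > 0"
  obtains z e where "e > 0" "e \<le> 1/2" "cball z e \<subseteq> ball z0 1" "g z0 \<le> 2 * e * g z"
    and "\<And>x. x \<in> cball z e \<Longrightarrow> g x \<le> 2 * g z"
proof -
  have "\<exists>z\<in>cball z0 1. \<forall>x\<in>cball z0 1. g x * (1 - dist z0 x) \<le> g z * (1 - dist z0 z)"
    by (rule continuous_attains_sup) (auto intro!: continuous_intros assms)
  then obtain z where z: "z \<in> cball z0 1"
    and max: "\<And>x. x \<in> cball z0 1 \<Longrightarrow> g x * (1 - dist z0 x) \<le> g z * (1 - dist z0 z)"
    by blast
  define e where "e = (1 - dist z0 z) / 2"
  have g0: "g z0 \<le> g z * (2 * e)"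
    using max[of z0] by (simp add: e_def algebra_simps)
  have "e \<ge> 0"
    using z by (auto simp: e_def)
  moreover have "g z * (2 * e) > 0"
    using g0 assms(2) by linarith
  ultimately have e: "e > 0" and gz: "g z > 0"
    by (auto simp: zero_less_mult_iff)
  have dist: "dist z0 x \<le> 1 - e" if "x \<in> cball z e" for x
    using that dist_triangle[of z0 x z] by (auto simp: e_def field_simps)
  show ?thesis
  proof (rule that[OF e])
    show "e \<le> 1/2" by (simp add: e_def)
    show "cball z e \<subseteq> ball z0 1"
      using dist e by force
    show "g z0 \<le> 2 * e * g z"
      using g0 by (simp add: algebra_simps)
    fix x assume x: "x \<in> cball z e"
    show "g x \<le> 2 * g z"
    proof (cases "g x \<le> 0")
      case False
      then have "g x * e \<le> g x * (1 - dist z0 x)"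
        using dist[OF x] by (intro mult_left_mono) auto
      also have "\<dots> \<le> g z * (2 * e)"
        using max[of x] dist[OF x] e by (simp add: e_def algebra_simps)
      finally show ?thesis
        using e by simp
    qed (use gz in auto)
  qed
qed

text \<open>Homogenized splitting of \<open>t^m + 1\<close>, whose roots are simple because its
  derivative vanishes at most at 0.\<close>

lemma power_add_power_eq_prod:
  fixes x y :: complex
  assumes "m > 0"
  shows "x ^ m + y ^ m = (\<Prod>w | w ^ m = -1. x - w * y)"
proof (cases "y = 0")
  case True
  then show ?thesis
    using assms by (simp add: card_nth_roots zero_power)
next
  case False
  define p :: "complex poly" where "p = monom 1 m + 1"
  have deg: "degree p = m"
    using assms unfolding p_def by (subst degree_add_eq_left) (auto simp: degree_monom_eq)
  have lead: "lead_coeff p = 1"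
    using assms unfolding deg by (simp add: p_def)
  have poly: "poly p z = z ^ m + 1" for z
    by (simp add: p_def poly_monom)
  have "rsquarefree p"
    unfolding rsquarefree_roots
  proof (safe)
    fix a assume a: "poly p a = 0" "poly (pderiv p) a = 0"
    from a(2) have "a ^ (m - 1) = 0"
      using assms by (simp add: p_def pderiv_add pderiv_monom poly_monom)
    then have "a = 0" by simp
    with a(1) assms show False by (simp add: poly zero_power)
  qed
  then have "p = (\<Prod>z | poly p z = 0. [:- z, 1:])"
    using complex_poly_decompose_rsquarefree[of p] lead by simp
  then have "poly p t = (\<Prod>z | z ^ m = -1. t - z)" for t
    by (simp add: poly eq_neg_iff_add_eq_0 poly_prod)
  then have fac: "t ^ m + 1 = (\<Prod>z | z ^ m = -1. t - z)" for t :: complex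
    by (simp add: poly)
  have "x ^ m + y ^ m = y ^ m * ((x / y) ^ m + 1)"
    using False by (simp add: field_simps)
  also have "\<dots> = (\<Prod>w | (w::complex) ^ m = -1. y) * (\<Prod>w | w ^ m = -1. x / y - w)"
    using assms by (simp add: fac card_nth_roots)
  also have "\<dots> = (\<Prod>w | w ^ m = -1. y * (x / y - w))"
    by (rule prod.distrib[symmetric])
  also have "\<dots> = (\<Prod>w | w ^ m = -1. x - w * y)"
    using False by (intro prod.cong) (auto simp: field_simps)
  finally show ?thesis .
qed

subsection \<open>Growth of the logarithmic derivatives\<close>

lemma norm_root_minus_1:
  assumes "(w::complex) ^ m = -1" "m > 0"
  shows "norm w = 1"
proof -
  have "norm w ^ m = 1 ^ m"
    using assms by (simp flip: norm_power)
  then show ?thesis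
    using assms(2) by (subst (asm) power_eq_iff_eq_base) auto
qed

lemma finite_set_separated:
  fixes W :: "'a::metric_space set"
  assumes "finite W"
  obtains d where "d > 0" "\<And>p q. p \<in> W \<Longrightarrow> q \<in> W \<Longrightarrow> p \<noteq> q \<Longrightarrow> d \<le> dist p q"
proof -
  \<comment> \<open>The inserted 1 keeps the minimum defined when \<open>W\<close> has fewer than
    two points.\<close>
  have fin: "finite (insert 1 ((\<lambda>(p, q). dist p q) ` (W \<times> W - Id)))"
    using assms by auto
  show ?thesis
  proof (rule that[of "Min (insert 1 ((\<lambda>(p, q). dist p q) ` (W \<times> W - Id)))"])
    show "Min (insert 1 ((\<lambda>(p, q). dist p q) ` (W \<times> W - Id))) > 0"
      using fin by (subst Min_gr_iff) auto
  qed (rule Min_le[OF fin], force)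
qed

text \<open>
  Here \<open>c w\<close> is the value of \<open>u\<^sub>w = f - w h\<close> at the selected point and \<open>b w\<close> its logarithmic
  derivative there, divided by the maximum \<open>M\<close> of these logarithmic derivatives; \<open>e1\<close> and \<open>e2\<close>
  say that \<open>f\<^bsup>(k)\<^esup>\<close> and \<open>f\<^bsup>(k+1)\<^esup>\<close> are small at the scale \<open>1/M\<close>.
  Since the \<open>b w\<close> almost sum to zero, some \<open>b q\<close> is far from the extremal \<open>b p\<close>. Eliminating
  \<open>c q\<close> between \<open>e1\<close> and \<open>e2\<close> shows that \<open>c p\<close> is negligible against \<open>c q\<close>, hence \<open>b q\<close> is small;
  writing every other \<open>u\<^sub>l\<close> as a combination of \<open>u\<^sub>p\<close> and \<open>u\<^sub>q\<close> shows that \<open>b l\<close> is small too.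
  Then only \<open>b p\<close> is left in the sum.
\<close>

lemma no_rescaled_limit:
  fixes b c :: "complex \<Rightarrow> complex" and F H F' H' p :: complex and d \<epsilon> :: real and m k :: nat
  defines "W \<equiv> {w::complex. w ^ m = -1}"
  assumes mk: "m \<ge> 2" "k \<ge> 1"
    and d: "d > 0" "\<And>p q. p \<in> W \<Longrightarrow> q \<in> W \<Longrightarrow> p \<noteq> q \<Longrightarrow> d \<le> dist p q"
    and \<epsilon>: "\<epsilon> > 0" "\<epsilon> \<le> 1/8" "\<epsilon> \<le> d/32" "\<epsilon> \<le> d / (12 * m) / 16" "\<epsilon> \<le> (d / (12 * m)) ^ k / 10"
    and p: "p \<in> W" "norm (b p) = 1"
    and b: "\<And>w. w \<in> W \<Longrightarrow> norm (b w) \<le> 1"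
    and c: "\<And>w. w \<in> W \<Longrightarrow> c w = F - w * H"
    and cb: "\<And>w. w \<in> W \<Longrightarrow> c w * b w = F' - w * H'"
    and nz: "\<And>w. w \<in> W \<Longrightarrow> c w \<noteq> 0"
    and e1: "\<And>q. q \<in> W \<Longrightarrow>
      norm (q * c p * b p ^ k - p * c q * b q ^ k) \<le> \<epsilon> * (norm (c p) + norm (c q))"
    and e2: "\<And>q. q \<in> W \<Longrightarrow>
      norm (q * c p * b p ^ Suc k - p * c q * b q ^ Suc k) \<le> \<epsilon> * (norm (c p) + norm (c q))"
    and sum: "norm (\<Sum>w\<in>W. b w) \<le> \<epsilon>"
  shows False
proof -
  have card: "card W = m" and fin: "finite W"
    using mk by (auto simp: W_def card_nth_roots intro: finite_nth_roots)
  have normW: "norm w = 1" if "w \<in> W" for w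
    using norm_root_minus_1[of w m] mk that by (auto simp: W_def)
  \<comment> \<open>Chosen so that \<open>3 * \<tau>\<close>, the final bound for
    \<open>d / 2 * norm (b l)\<close>, equals \<open>d / 2 * (1 / (2 * m))\<close>.\<close>
  define \<tau> where "\<tau> = d / (12 * m)"
  have \<tau>: "\<tau> > 0"
    using d mk by (simp add: \<tau>_def)
  note \<epsilon> = \<epsilon>[folded \<tau>_def]
  have sum': "norm (\<Sum>w\<in>W. b w) \<le> 1/8"
    using sum \<epsilon> by linarith
  \<comment> \<open>Otherwise all \<open>b w\<close> lie within 1/2 of the unit vector
    \<open>b p\<close>, and their sum has norm at least \<open>m / 2\<close>.\<close>
  have "\<exists>q\<in>W. norm (b q - b p) \<ge> 1/2"
  proof (rule ccontr)
    assume "\<not> ?thesis"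
    then have less: "norm (b q - b p) \<le> 1/2" if "q \<in> W" for q
      using that by force
    have "real m = norm (of_nat m * b p)"
      by (simp add: norm_mult p)
    also have "of_nat m * b p = (\<Sum>w\<in>W. b w) - (\<Sum>w\<in>W. b w - b p)"
      by (simp add: sum_subtractf card)
    also have "norm \<dots> \<le> 1/8 + (\<Sum>w\<in>W. 1/2)"
      by (intro order.trans[OF norm_triangle_ineq4] add_mono sum' sum_norm_le less)
    finally show False
      using mk by (simp add: card)
  qed
  then obtain q where q: "q \<in> W" "norm (b q - b p) \<ge> 1/2"
    by blast
  have qm: "q \<in> W" and "p \<in> W"
    using q p by auto
  have np: "norm p = 1" and nq: "norm q = 1"
    using normW q \<open>p \<in> W\<close> by auto
  have "norm (c p) * (1/2) \<le> norm (c p) * norm (b q - b p)"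
    using q by (intro mult_left_mono) auto
  also have "\<dots> = norm (q * c p * b p ^ k * (b p - b q))"
    by (simp add: norm_mult norm_power nq p norm_minus_commute)
  \<comment> \<open>Subtracting \<open>b q\<close> times the expression in \<open>e1\<close> from
    that in \<open>e2\<close> cancels \<open>c q\<close>.\<close>
  also have "q * c p * b p ^ k * (b p - b q) =
      (q * c p * b p ^ Suc k - p * c q * b q ^ Suc k) - b q * (q * c p * b p ^ k - p * c q * b q ^ k)"
    by (simp add: algebra_simps)
  also have "norm \<dots> \<le> \<epsilon> * (norm (c p) + norm (c q)) + 1 * (\<epsilon> * (norm (c p) + norm (c q)))"
    using mult_mono[OF b[OF qm] e1[OF qm]]
    by (intro order.trans[OF norm_triangle_ineq4 add_mono[OF e2[OF qm]]]) (simp add: norm_mult)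
  finally have "norm (c p) \<le> 4 * \<epsilon> * (norm (c p) + norm (c q))"
    by simp
  also have "\<dots> \<le> 1/2 * norm (c p) + 4 * \<epsilon> * norm (c q)"
    using mult_right_mono[OF \<epsilon>(2) norm_ge_zero[of "c p"]] by (simp add: algebra_simps)
  finally have cp: "norm (c p) \<le> 8 * \<epsilon> * norm (c q)"
    by simp
  also have "\<dots> \<le> 1 * norm (c q)"
    using \<epsilon> by (intro mult_right_mono) auto
  finally have cpq: "norm (c p) \<le> norm (c q)"
    by simp
  have cq: "norm (c q) > 0"
    using nz qm by simp
  \<comment> \<open>Once \<open>c p\<close> is known to be negligible, \<open>e1\<close> leaves only
    the term with \<open>c q * b q ^ k\<close>.\<close>
  have "norm (c q) * norm (b q) ^ k = norm (q * c p * b p ^ k - (q * c p * b p ^ k - p * c q * b q ^ k))"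
    by (simp add: norm_mult norm_power np)
  also have "\<dots> \<le> norm (c p) + \<epsilon> * (norm (c p) + norm (c q))"
    by (rule order.trans[OF norm_triangle_ineq4 add_mono[OF _ e1[OF qm]]]) (simp add: norm_mult norm_power nq p)
  also have "\<dots> \<le> 8 * \<epsilon> * norm (c q) + \<epsilon> * (norm (c q) + norm (c q))"
    using cp cpq \<epsilon> by (intro add_mono mult_left_mono) auto
  also have "\<dots> = norm (c q) * (10 * \<epsilon>)"
    by simp
  finally have "norm (b q) ^ k \<le> 10 * \<epsilon>"
    using cq by simp
  then have "norm (b q) ^ k \<le> \<tau> ^ k"
    using \<epsilon> by simp
  then have bq: "norm (b q) \<le> \<tau>"
    using \<tau> mk by (subst (asm) power_mono_iff) auto
  have bl: "norm (b l) \<le> 1 / (2 * m)" if l: "l \<in> W - {p}" for l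
  proof -
    have lm: "l \<in> W" and nl: "norm l = 1" and dl: "norm (l - p) \<ge> d"
      using l d(2)[of l p] \<open>p \<in> W\<close> normW by (auto simp: dist_norm)
    have ql: "norm (q - l) \<le> 2"
      using norm_triangle_ineq4[of q l] nl nq by simp
    have lp: "norm (l - p) \<le> 2"
      using norm_triangle_ineq4[of l p] nl np by simp
    \<comment> \<open>Both \<open>c w\<close> and \<open>c w * b w\<close> are affine in
      \<open>w\<close>, so their values at \<open>l\<close> are interpolated from those at
      \<open>p\<close> and \<open>q\<close>. The first interpolation bounds \<open>c l\<close> from
      below, the second bounds \<open>c l * b l\<close> from above.\<close>
    have "d / 2 * norm (c q) \<le> d * norm (c q) - 2 * (8 * \<epsilon> * norm (c q))"
      using mult_right_mono[OF \<epsilon>(3) norm_ge_zero[of "c q"]] by (simp add: algebra_simps)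
    also have "\<dots> \<le> norm ((l - p) * c q) - norm ((q - l) * c p)"
      unfolding norm_mult using dl ql cp by (intro diff_mono mult_mono) auto
    also have "\<dots> \<le> norm ((l - p) * c q + (q - l) * c p)"
      by (rule norm_diff_ineq)
    also have "(l - p) * c q + (q - l) * c p = (q - p) * c l"
      by (simp add: c qm lm p algebra_simps)
    finally have 1: "d / 2 * norm (c q) \<le> norm ((q - p) * c l)" .
    have "d / 2 * norm (c q) * norm (b l) \<le> norm ((q - p) * c l) * norm (b l)"
      using 1 by (intro mult_right_mono) auto
    also have "\<dots> = norm ((q - p) * (c l * b l))"
      by (simp add: norm_mult)
    also have "(q - p) * (c l * b l) = (l - p) * (c q * b q) + (q - l) * (c p * b p)"
      unfolding cb[OF qm] cb[OF lm] cb[OF p(1)] by (simp add: algebra_simps)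
    also have "norm \<dots> \<le> 2 * (norm (c q) * \<tau>) + 2 * (norm (c p) * 1)"
      unfolding norm_mult using lp ql bq p
      by (intro order.trans[OF norm_triangle_ineq]) (simp only: norm_mult, intro add_mono mult_mono, auto)
    also have "\<dots> \<le> 2 * (norm (c q) * \<tau>) + 2 * (8 * \<epsilon> * norm (c q))"
      using cp by simp
    also have "\<dots> \<le> 3 * \<tau> * norm (c q)"
      using mult_right_mono[OF \<epsilon>(4) norm_ge_zero[of "c q"]] by (simp add: algebra_simps)
    finally have "d / 2 * norm (b l) * norm (c q) \<le> 3 * \<tau> * norm (c q)"
      by (simp add: mult_ac)
    then have "d / 2 * norm (b l) \<le> 3 * \<tau>"
      using cq by simp
    also have "3 * \<tau> = d / 2 * (1 / (2 * m))"
      by (simp add: \<tau>_def)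
    finally show ?thesis
      using d(1) by (simp only: mult_le_cancel_left_pos half_gt_zero_iff)
  qed
  have "norm (\<Sum>w\<in>W-{p}. b w) \<le> (m - 1) * (1 / (2 * m))"
    using sum_norm_bound[of "W - {p}" b, OF bl] fin \<open>p \<in> W\<close> by (simp add: card)
  also have "\<dots> \<le> m * (1 / (2 * m))"
    by (intro mult_right_mono) auto
  finally have "norm (\<Sum>w\<in>W-{p}. b w) \<le> 1 / 2"
    using mk by simp
  moreover have "b p = (\<Sum>w\<in>W. b w) - (\<Sum>w\<in>W-{p}. b w)"
    using fin \<open>p \<in> W\<close> by (simp add: sum_diff1)
  ultimately have "norm (b p) \<le> 1/8 + 1/2"
    using norm_triangle_ineq4[of "\<Sum>w\<in>W. b w" "\<Sum>w\<in>W-{p}. b w"] sum' by simp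
  then show False
    using p by simp
qed

text \<open>Cauchy's inequality on discs of radius \<open>e/2\<close> about the points of the half
  disc bounds the derivative by \<open>2 * B / e\<close>; the mean value inequality does the
  rest.\<close>

lemma norm_diff_le_of_bounded_on_cball:
  fixes \<phi> :: "complex \<Rightarrow> complex"
  assumes "\<phi> holomorphic_on A" "open A" "cball z e \<subseteq> A"
    and bound: "\<And>x. x \<in> cball z e \<Longrightarrow> norm (\<phi> x) \<le> B"
    and x: "x \<in> cball z (e/2)" and "e > 0"
  shows "norm (\<phi> x - \<phi> z) \<le> 2 * B / e * norm (x - z)"
proof (rule field_differentiable_bound[where S = "cball z (e/2)" and f' = "deriv \<phi>"])
  fix y assume y: "y \<in> cball z (e/2)"
  have sub: "cball y (e/2) \<subseteq> cball z e"
  proof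
    fix t assume "t \<in> cball y (e/2)"
    then show "t \<in> cball z e"
      using y dist_triangle[of z t y] by simp
  qed
  have "y \<in> A"
    using sub assms(3,6) by (auto simp: subset_iff)
  then show "(\<phi> has_field_derivative deriv \<phi> y) (at y within cball z (e/2))"
    using holomorphic_derivI[OF assms(1,2)] has_field_derivative_at_within by blast
  have "norm ((deriv ^^ 1) \<phi> y) \<le> fact 1 * B / (e/2) ^ 1"
  proof (rule Cauchy_inequality)
    have "\<phi> holomorphic_on cball y (e/2)"
      using assms(1) by (rule holomorphic_on_subset) (use assms(3) sub in blast)
    then show "\<phi> holomorphic_on ball y (e/2)" "continuous_on (cball y (e/2)) \<phi>"
      by (auto intro: holomorphic_on_subset holomorphic_on_imp_continuous_on)
    show "norm (\<phi> t) \<le> B" if "norm (y - t) = e/2" for t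
      using that sub by (intro bound) (auto simp: subset_iff dist_norm)
  qed (use \<open>e > 0\<close> in auto)
  then show "norm (deriv \<phi> y) \<le> 2 * B / e"
    by (simp add: mult.commute)
qed (use x \<open>e > 0\<close> in auto)

text \<open>In the application \<open>S\<close> is \<open>1/R\<close>, \<open>h\<close> is
  \<open>R f^(k)\<close> and \<open>s\<close> is the logarithmic derivative of
  \<open>Q e^\<alpha>\<close>. The conclusion starts at \<open>r0 + 2\<close> so that the disc of
  radius 2 about each point considered lies in \<open>A\<close>.\<close>

lemma log_deriv_polynomial_growth:
  fixes f h S s :: "complex \<Rightarrow> complex" and r0 C :: real and m k N :: nat
  defines "A \<equiv> {z. r0 < norm z}" and "W \<equiv> {w::complex. w ^ m = -1}"
  defines "\<phi> \<equiv> \<lambda>w z. (deriv f z - w * deriv h z) / (f z - w * h z)"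
  assumes mk: "m \<ge> 2" "k \<ge> 1" and r0: "r0 \<ge> 1" and C: "C \<ge> 0"
    and hol: "f holomorphic_on A" "h holomorphic_on A" "S holomorphic_on A"
    and eq: "\<And>z. z \<in> A \<Longrightarrow> (deriv ^^ k) f z = S z * h z"
    and nz: "\<And>z w. z \<in> A \<Longrightarrow> w \<in> W \<Longrightarrow> f z - w * h z \<noteq> 0"
    and sum: "\<And>z. z \<in> A \<Longrightarrow> (\<Sum>w\<in>W. \<phi> w z) = s z"
    and S: "\<And>z. z \<in> A \<Longrightarrow> norm (S z) \<le> C * norm z ^ N"
    and s: "\<And>z. z \<in> A \<Longrightarrow> norm (s z) \<le> C * norm z ^ N"
  obtains C' where "C' \<ge> 0"
    "\<And>z w. norm z > r0 + 2 \<Longrightarrow> w \<in> W \<Longrightarrow> norm (\<phi> w z) \<le> C' * norm z ^ N"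
proof -
  have fin: "finite W" and card: "card W = m"
    using mk by (auto simp: W_def card_nth_roots intro: finite_nth_roots)

  \<comment> \<open>Choice of the constants\<close>
  obtain d where d: "d > 0" "\<And>p q. p \<in> W \<Longrightarrow> q \<in> W \<Longrightarrow> p \<noteq> q \<Longrightarrow> d \<le> dist p q"
    using finite_set_separated[OF fin] by blast
  \<comment> \<open>The minimum of the four upper bounds required by
    \<open>no_rescaled_limit\<close>.\<close>
  define \<epsilon> where "\<epsilon> = Min {1/8, d/32, d / (12 * m) / 16, (d / (12 * m)) ^ k / 10}"
  have \<epsilon>: "\<epsilon> > 0" "\<epsilon> \<le> 1/8" "\<epsilon> \<le> d/32" "\<epsilon> \<le> d / (12 * m) / 16" "\<epsilon> \<le> (d / (12 * m)) ^ k / 10"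
    using d(1) mk by (auto simp: \<epsilon>_def)
  \<comment> \<open>\<open>E\<close> serves in \<open>higher_deriv_approx_exp\<close> for all orders
    up to \<open>k + 1\<close> with \<open>B = 2 * m\<close>. The budget \<open>\<epsilon>\<close>
    is then split: \<open>E * \<eta>\<close> for the exponential approximation,
    \<open>2 * \<eta>\<close> for the contribution of \<open>f^(k)\<close> and
    \<open>f^(k+1)\<close>.\<close>
  define E where "E = Suc k * fact (Suc k) * exp (2 * real m)"
  define \<eta> where "\<eta> = \<epsilon> / (2 + E)"
  have E: "E \<ge> 0"
    by (simp add: E_def)
  have \<eta>: "\<eta> > 0" "\<eta> \<le> \<epsilon>" "\<eta> < 1" and \<eta>E: "2 * \<eta> + E * \<eta> = \<epsilon>"
  proof -
    have "\<epsilon> / (2 + E) \<le> \<epsilon> / 1"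
      using \<epsilon>(1) E by (intro divide_left_mono) auto
    then show "\<eta> > 0" "\<eta> \<le> \<epsilon>" "\<eta> < 1"
      using \<epsilon>(1,2) E by (auto simp: \<eta>_def)
    show "2 * \<eta> + E * \<eta> = \<epsilon>"
      using E unfolding \<eta>_def distrib_right[symmetric] by simp
  qed
  have "W \<noteq> {}"
    using card mk by auto
  have normW: "norm w = 1" if "w \<in> W" for w
    using norm_root_minus_1[of w m] mk that by (auto simp: W_def)
  have "open A"
    unfolding A_def by (intro open_Collect_less continuous_intros)
  have hol\<phi>: "\<phi> w holomorphic_on A" if "w \<in> W" for w
    unfolding \<phi>_def using hol nz[OF _ that] \<open>open A\<close> by (intro holomorphic_intros) auto
  \<comment> \<open>The first summand will limit the variation of \<open>\<phi> w\<close> on the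
    disc of radius \<open>1/M\<close> to \<open>\<eta> * M\<close>; the second will make the bound
    \<open>H\<close> for \<open>S\<close> and \<open>s\<close> at most
    \<open>\<eta> * M\<close>.\<close>
  define C' where "C' = 8 * m\<^sup>2 / \<eta> + m * C * 3 ^ N / \<eta>"
  have C'0: "C' \<ge> 0"
    using \<eta> C by (auto simp: C'_def)
  have "norm (\<phi> w0 z0) \<le> C' * norm z0 ^ N" if z0: "norm z0 > r0 + 2" and w0: "w0 \<in> W" for z0 w0
  proof (rule ccontr)
    assume "\<not> ?thesis"
    then have large: "norm (\<phi> w0 z0) > C' * norm z0 ^ N"
      by simp

    \<comment> \<open>Selection of a point with large logarithmic derivatives\<close>
    define g where "g x = (\<Sum>w\<in>W. norm (\<phi> w x))" for x
    have le_g: "norm (\<phi> w x) \<le> g x" if "w \<in> W" for w x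
      unfolding g_def using that fin by (intro member_le_sum) auto
    \<comment> \<open>Points within 2 of \<open>z0\<close> have norm at most
      \<open>3 * norm z0\<close>, so \<open>H\<close> bounds \<open>S\<close> and \<open>s\<close>
      there.\<close>
    define H where "H = C * 3 ^ N * norm z0 ^ N"
    have near: "x \<in> A" "norm x ^ N \<le> 3 ^ N * norm z0 ^ N" if "x \<in> ball z0 2" for x
    proof -
      have 1: "norm (x - z0) < 2"
        using that by (simp add: dist_norm norm_minus_commute)
      show "x \<in> A"
        using z0 norm_triangle_ineq2[of z0 "z0 - x"] 1 by (auto simp: A_def norm_minus_commute)
      have "norm x \<le> 3 * norm z0"
        using z0 r0 norm_triangle_ineq[of z0 "x - z0"] 1 by simp
      then show "norm x ^ N \<le> 3 ^ N * norm z0 ^ N"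
        by (metis norm_ge_zero power_mono power_mult_distrib)
    qed
    have boundS: "norm (S x) \<le> H" and bounds: "norm (s x) \<le> H" if "x \<in> ball z0 2" for x
      using S[OF near(1)[OF that]] s[OF near(1)[OF that]] mult_left_mono[OF near(2)[OF that] C]
      by (auto simp: H_def mult.assoc)
    have cball_sub: "cball z0 1 \<subseteq> A"
      using near(1) by auto
    have "norm z0 ^ N \<ge> 1"
      using z0 r0 by (intro one_le_power) auto
    have g_large: "g z0 > C' * norm z0 ^ N"
      using le_g[OF w0, of z0] large by linarith
    then have g_large': "g z0 > 8 * m\<^sup>2 / \<eta>" and H_small: "H \<le> \<eta> * (g z0 / m)"
    proof -
      have "C' * norm z0 ^ N \<ge> C' * 1"
        using \<open>norm z0 ^ N \<ge> 1\<close> C'0 by (intro mult_left_mono)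
      moreover have "C' \<ge> 8 * m\<^sup>2 / \<eta>"
        unfolding C'_def using C \<eta> by simp
      ultimately show "g z0 > 8 * m\<^sup>2 / \<eta>"
        using g_large by linarith
      have "m * C * 3 ^ N / \<eta> * norm z0 ^ N \<le> C' * norm z0 ^ N"
        unfolding C'_def using \<eta> by (intro mult_right_mono) auto
      then have "m * H / \<eta> \<le> g z0"
        using g_large unfolding H_def by (simp add: mult_ac)
      then show "H \<le> \<eta> * (g z0 / m)"
        using \<eta> mk by (simp add: field_simps)
    qed
    have cont: "continuous_on (cball z0 1) g"
      unfolding g_def using hol\<phi> cball_sub
      by (intro continuous_intros) (meson holomorphic_on_imp_continuous_on continuous_on_subset)
    have "8 * m\<^sup>2 / \<eta> \<ge> 8 * m\<^sup>2"
      using divide_left_mono[of \<eta> 1 "8 * real m ^ 2"] \<eta> by simp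
    moreover have "real (m\<^sup>2) \<ge> m"
      using mk by (simp add: power2_eq_square)
    ultimately have gm: "g z0 \<ge> 8 * m"
      using g_large' by linarith
    then have "g z0 > 0"
      using mk by linarith
    from doubling_point[OF cont this] obtain z e where e: "e > 0" "e \<le> 1/2"
      and sub: "cball z e \<subseteq> ball z0 1" and gz: "g z0 \<le> 2 * e * g z"
      and doubling: "\<And>x. x \<in> cball z e \<Longrightarrow> g x \<le> 2 * g z"
      by metis
    \<comment> \<open>The maximum \<open>M\<close> and the sum \<open>g z\<close> differ at most by
      the factor \<open>m\<close>, so \<open>g z0 \<le> 2 * e * g z\<close> becomes a lower bound
      for \<open>e * M\<close>.\<close>
    define Mx where "Mx = Max ((\<lambda>w. norm (\<phi> w z)) ` W)"
    have "Mx \<in> (\<lambda>w. norm (\<phi> w z)) ` W"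
      unfolding Mx_def using fin \<open>W \<noteq> {}\<close> by (intro Max_in) auto
    moreover have "norm (\<phi> w z) \<le> Mx" if "w \<in> W" for w
      unfolding Mx_def using fin that by (intro Max_ge) auto
    ultimately obtain p where p: "p \<in> W" and max: "\<And>w. w \<in> W \<Longrightarrow> norm (\<phi> w z) \<le> norm (\<phi> p z)"
      by auto
    define M where "M = norm (\<phi> p z)"
    have gM: "g z \<le> m * M"
      using sum_bounded_above[of W "\<lambda>w. norm (\<phi> w z)" M] max by (simp add: g_def card M_def)
    have "2 * e * g z \<le> 2 * e * (m * M)"
      using e gM by (intro mult_left_mono) auto
    with gz have K: "g z0 \<le> 2 * e * m * M"
      by (simp add: mult.assoc)
    have M0: "M \<ge> 0"
      by (simp add: M_def)
    have K': "g z0 \<le> m * M"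
      using K mult_right_mono[of "2 * e" 1 "m * M"] e M0 by (simp add: mult.assoc)
    have "8 * m \<le> m * M"
      using gm K' by linarith
    then have M: "M \<ge> 8"
      using mk by simp
    have "H \<le> \<eta> * M"
    proof -
      have "g z0 / m \<le> M"
        using K' mk by (simp add: field_simps)
      then show ?thesis
        using H_small mult_left_mono[of "g z0 / m" M \<eta>] \<eta> by linarith
    qed
    \<comment> \<open>From \<open>8 * m \<le> g z0 \<le> 2 * e * m * M\<close>: the disc of radius
      \<open>1/M\<close> fits into the half disc where the variation of \<open>\<phi> w\<close> is
      controlled.\<close>
    have rad: "1 / M \<le> e / 2"
    proof -
      have "8 * m \<le> 2 * e * m * M"
        using gm K by linarith
      then show ?thesis
        using mk M by (simp add: field_simps)
    qed
    have subA: "cball z e \<subseteq> A"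
      using sub cball_sub ball_subset_cball by blast
    have zA: "z \<in> A" and z1: "z \<in> ball z0 1"
      using subA sub e by (auto simp: subset_iff)

    \<comment> \<open>Exponential approximation at the selected point\<close>
    define u where "u w x = f x - w * h x" for w x
    have holu: "u w holomorphic_on A" for w
      unfolding u_def using hol by (intro holomorphic_intros)
    have du: "deriv (u w) x = deriv f x - w * deriv h x" if "x \<in> A" for w x
    proof -
      have "(f has_field_derivative deriv f x) (at x)" "(h has_field_derivative deriv h x) (at x)"
        using hol \<open>open A\<close> that by (auto intro: holomorphic_derivI)
      then show ?thesis
        unfolding u_def by (intro DERIV_imp_deriv) (auto intro!: derivative_eq_intros)
    qed
    have approx: "norm ((deriv ^^ n) (u w) z - \<phi> w z ^ n * u w z)
        \<le> n * fact n * (\<eta> * exp (2 * real m)) * M ^ n * norm (u w z)" if w: "w \<in> W" for w n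
    proof (rule higher_deriv_approx_exp[where \<phi> = "\<phi> w"])
      have cb: "x \<in> cball z (e/2)" "x \<in> cball z e" if "x \<in> cball z (1/M)" for x
        using that rad e by auto
      show "cball z (1/M) \<subseteq> A"
        using cb subA by blast
      fix x assume x: "x \<in> cball z (1/M)"
      then have "x \<in> A"
        using cb subA by blast
      then show "deriv (u w) x = \<phi> w x * u w x"
        using nz[OF _ w] by (simp add: du) (simp add: \<phi>_def u_def)
      have B: "norm (\<phi> w y) \<le> 2 * real m * M" if "y \<in> cball z e" for y
        using le_g[OF w, of y] doubling[OF that] gM by linarith
      then show "norm (\<phi> w x) \<le> 2 * real m * M"
        using cb[OF x] by simp
      \<comment> \<open>The derivative of \<open>\<phi> w\<close> is at most
        \<open>4 * m * M / e\<close>, so over a distance \<open>1/M\<close> the variation is at most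
        \<open>4 * m / e\<close>; \<open>g z0 > 8 * m^2 / \<eta>\<close> makes this at most
        \<open>\<eta> * M\<close>.\<close>
      have "norm (\<phi> w x - \<phi> w z) \<le> 2 * (2 * real m * M) / e * norm (x - z)"
        by (rule norm_diff_le_of_bounded_on_cball[OF hol\<phi>[OF w] \<open>open A\<close> subA])
           (use B cb[OF x] e in auto)
      also have "\<dots> \<le> 2 * (2 * real m * M) / e * (1 / M)"
        using x e M by (intro mult_left_mono) (auto simp: dist_norm norm_minus_commute)
      also have "\<dots> = 4 * m / e"
        using M by simp
      also have "\<dots> \<le> \<eta> * M"
      proof -
        have "8 * m\<^sup>2 / \<eta> \<le> 2 * e * m * M"
          using g_large' K by linarith
        then have "8 * m\<^sup>2 \<le> \<eta> * (2 * e * m * M)"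
          using \<eta> by (simp add: field_simps)
        then have "(2 * real m) * (4 * real m) \<le> (2 * real m) * (\<eta> * M * e)"
          by (simp add: power2_eq_square mult_ac)
        then have "4 * real m \<le> \<eta> * M * e"
          using mk by (subst (asm) mult_le_cancel_left_pos) auto
        then show ?thesis
          using e by (simp add: field_simps)
      qed
      finally show "norm (\<phi> w x - \<phi> w z) \<le> \<eta> * M" .
    qed (use holu \<open>open A\<close> M max[OF w] in \<open>auto simp: M_def\<close>)
    have approxE: "norm ((deriv ^^ n) (u w) z - \<phi> w z ^ n * u w z) \<le> E * \<eta> * M ^ n * norm (u w z)"
      if w: "w \<in> W" and n: "n \<le> Suc k" for w n
    proof -
      have "real (n * fact n) * (\<eta> * exp (2 * real m)) \<le> real (Suc k * fact (Suc k)) * (\<eta> * exp (2 * real m))"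
        using n \<eta> by (intro mult_right_mono of_nat_mono mult_le_mono fact_mono_nat) auto
      also have "\<dots> = E * \<eta>"
        by (simp add: E_def)
      finally show ?thesis
        using M by (intro order.trans[OF approx[OF w]] mult_right_mono) auto
    qed
    \<comment> \<open>Cauchy's inequality with radius 1: the unit disc about \<open>z\<close> stays
      within distance 2 of \<open>z0\<close>, where \<open>H\<close> bounds
      \<open>S\<close>.\<close>
    have boundS': "norm (deriv S z) \<le> H"
    proof -
      have sub': "cball z 1 \<subseteq> ball z0 2"
      proof
        fix t assume "t \<in> cball z 1"
        then show "t \<in> ball z0 2"
          using z1 dist_triangle[of z0 t z] by simp
      qed
      then have "S holomorphic_on cball z 1"
        using hol(3) near(1) by (meson holomorphic_on_subset subsetI subsetD)
      then have "norm ((deriv ^^ 1) S z) \<le> fact 1 * H / 1 ^ 1"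
        using sub' by (intro Cauchy_inequality boundS)
          (auto intro: holomorphic_on_subset holomorphic_on_imp_continuous_on simp: subset_iff dist_norm)
      then show ?thesis by simp
    qed
    have zz: "z \<in> ball z0 2"
      using z1 by auto
    have M1: "M ^ 1 \<le> M ^ k"
      using M mk by (intro power_increasing) auto
    have HMk: "H \<le> \<eta> * M ^ k"
      using \<open>H \<le> \<eta> * M\<close> mult_left_mono[OF M1, of \<eta>] \<eta> by (auto intro: order.trans)

    \<comment> \<open>Relations between the factors and the derivatives of \<open>f\<close>\<close>
    define a where "a w = \<phi> w z" for w
    define c where "c w = u w z" for w
    \<comment> \<open>The combination \<open>q * u p - p * u q\<close> eliminates
      \<open>h\<close>.\<close>
    have rel: "q * (deriv ^^ n) (u p) x - p * (deriv ^^ n) (u q) x = (q - p) * (deriv ^^ n) f x"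
      if "x \<in> A" for p q n x
    proof -
      have "q * (deriv ^^ n) (u p) x - p * (deriv ^^ n) (u q) x
          = (deriv ^^ n) (\<lambda>x. q * u p x - p * u q x) x"
        using holu \<open>open A\<close> that
        by (subst higher_deriv_diff[where S=A] higher_deriv_cmult[where A=A], auto intro!: holomorphic_intros)+
      also have "(\<lambda>x. q * u p x - p * u q x) = (\<lambda>x. (q - p) * f x)"
        by (auto simp: u_def algebra_simps)
      also have "(deriv ^^ n) \<dots> x = (q - p) * (deriv ^^ n) f x"
        using hol \<open>open A\<close> that by (intro higher_deriv_cmult)
      finally show ?thesis .
    qed
    \<comment> \<open>Since \<open>u p - u q = (q - p) * h\<close>, the relation
      \<open>f^(k) = S h\<close> becomes an identity in the factors, which \<open>eqSk\<close>
      differentiates once.\<close>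
    have eqk: "(q - p) * (deriv ^^ k) f x = S x * (u p x - u q x)" if "x \<in> A" for p q x
      using eq[OF that] by (simp add: u_def algebra_simps)
    have duc: "deriv (u w) z = a w * c w" if "w \<in> W" for w
      using nz[OF zA that] by (simp add: du zA a_def c_def \<phi>_def u_def)
    have eqSk: "(q - p) * (deriv ^^ Suc k) f z
        = deriv S z * (c p - c q) + S z * (a p * c p - a q * c q)" if "p \<in> W" "q \<in> W" for p q
    proof -
      have "((deriv ^^ k) f) holomorphic_on A"
        using hol \<open>open A\<close> by (intro holomorphic_higher_deriv)
      then have "((\<lambda>x. (q - p) * (deriv ^^ k) f x) has_field_derivative (q - p) * (deriv ^^ Suc k) f z) (at z)"
        using \<open>open A\<close> zA by (auto intro!: DERIV_cmult holomorphic_derivI)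
      then have "((\<lambda>x. S x * (u p x - u q x)) has_field_derivative (q - p) * (deriv ^^ Suc k) f z) (at z)"
        by (rule has_field_derivative_transform_within_open[OF _ \<open>open A\<close> zA]) (simp add: eqk)
      moreover have "((\<lambda>x. S x * (u p x - u q x)) has_field_derivative
          deriv S z * (u p z - u q z) + S z * (deriv (u p) z - deriv (u q) z)) (at z)"
        using holomorphic_derivI[OF hol(3) \<open>open A\<close> zA] holomorphic_derivI[OF holu \<open>open A\<close> zA]
        by (auto intro!: derivative_eq_intros)
      ultimately show ?thesis
        using that by (simp add: DERIV_unique duc c_def)
    qed
    have main: "norm (q * c p * a p ^ n - p * c q * a q ^ n) \<le> \<epsilon> * M ^ n * (norm (c p) + norm (c q))"
      if q: "q \<in> W" and n: "n \<le> Suc k"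
        and rhs: "norm ((q - p) * (deriv ^^ n) f z) \<le> 2 * \<eta> * M ^ n * (norm (c p) + norm (c q))" for q n
    proof -
      have "q * c p * a p ^ n - p * c q * a q ^ n = (q - p) * (deriv ^^ n) f z
           - (q * ((deriv ^^ n) (u p) z - a p ^ n * c p) - p * ((deriv ^^ n) (u q) z - a q ^ n * c q))"
        unfolding rel[OF zA, symmetric] by (simp add: algebra_simps)
      also have "norm \<dots> \<le> 2 * \<eta> * M ^ n * (norm (c p) + norm (c q))
          + (E * \<eta> * M ^ n * norm (c p) + E * \<eta> * M ^ n * norm (c q))"
        using approxE[OF p n] approxE[OF q n] normW[OF p] normW[OF q]
        by (intro order.trans[OF norm_triangle_ineq4 add_mono[OF rhs order.trans[OF norm_triangle_ineq4 add_mono]]])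
           (simp_all add: norm_mult a_def c_def)
      also have "\<dots> = (2 * \<eta> + E * \<eta>) * M ^ n * (norm (c p) + norm (c q))"
        by (simp add: algebra_simps)
      finally show ?thesis
        by (simp only: \<eta>E)
    qed
    have scaled: "norm (q * c p * (a p / M) ^ n - p * c q * (a q / M) ^ n) \<le> \<epsilon> * (norm (c p) + norm (c q))"
      if "norm (q * c p * a p ^ n - p * c q * a q ^ n) \<le> \<epsilon> * M ^ n * (norm (c p) + norm (c q))" for q n
    proof -
      have "q * c p * (a p / M) ^ n - p * c q * (a q / M) ^ n = (q * c p * a p ^ n - p * c q * a q ^ n) / M ^ n"
        by (simp add: power_divide diff_divide_distrib)
      then have "norm (q * c p * (a p / M) ^ n - p * c q * (a q / M) ^ n)
          = norm (q * c p * a p ^ n - p * c q * a q ^ n) / M ^ n"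
        using M by (simp add: norm_divide norm_power del: of_real_power)
      also have "\<dots> \<le> \<epsilon> * M ^ n * (norm (c p) + norm (c q)) / M ^ n"
        using that M by (intro divide_right_mono) auto
      also have "\<dots> = \<epsilon> * (norm (c p) + norm (c q))"
        using M by simp
      finally show ?thesis .
    qed
    have diff_c: "norm (c p - c q) \<le> norm (c p) + norm (c q)" for q
      by (rule norm_triangle_ineq4)
    have norm_a: "norm (a w) \<le> M" if "w \<in> W" for w
      using max[OF that] by (simp add: a_def M_def)

    \<comment> \<open>Rescaling by \<open>M\<close> and contradiction\<close>
    show False
    proof (rule no_rescaled_limit[where b = "\<lambda>w. a w / M" and c = c and p = p
            and m = m and k = k and d = d and \<epsilon> = \<epsilon>, folded W_def])
      show "norm (a p / M) = 1"
        using p M by (auto simp: a_def M_def norm_divide)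
      fix w assume w: "w \<in> W"
      show "norm (a w / M) \<le> 1"
        using norm_a[OF w] M by (simp add: norm_divide)
      show "c w = f z - w * h z"
        by (simp add: c_def u_def)
      show "c w * (a w / M) = deriv f z / M - w * (deriv h z / M)"
        using duc[OF w] du[OF zA, of w] by (simp add: diff_divide_distrib mult.commute)
           (metis diff_divide_distrib mult.commute times_divide_eq_right)
      show "c w \<noteq> 0"
        using nz[OF zA w] by (simp add: c_def u_def)
      show "norm (w * c p * (a p / M) ^ k - p * c w * (a w / M) ^ k) \<le> \<epsilon> * (norm (c p) + norm (c w))"
      proof (intro scaled main w)
        have "norm ((w - p) * (deriv ^^ k) f z) \<le> H * (norm (c p) + norm (c w))"
          unfolding eqk[OF zA] norm_mult using boundS[OF zz] diff_c[of w]
          by (intro mult_mono) (auto simp: c_def intro: order.trans[OF norm_ge_zero])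
        also have "\<dots> \<le> 2 * \<eta> * M ^ k * (norm (c p) + norm (c w))"
        proof (rule mult_right_mono)
          show "H \<le> 2 * \<eta> * M ^ k"
            using HMk \<eta> M by (intro order.trans[OF HMk] mult_right_mono) auto
        qed auto
        finally show "norm ((w - p) * (deriv ^^ k) f z) \<le> 2 * \<eta> * M ^ k * (norm (c p) + norm (c w))" .
      qed auto
      show "norm (w * c p * (a p / M) ^ Suc k - p * c w * (a w / M) ^ Suc k) \<le> \<epsilon> * (norm (c p) + norm (c w))"
      proof (intro scaled main w)
        have H0: "H \<ge> 0"
          using boundS' norm_ge_zero order.trans by blast
        have ac: "norm (a p * c p - a w * c w) \<le> M * (norm (c p) + norm (c w))"
          unfolding distrib_left using norm_a[OF p] norm_a[OF w]
          by (intro order.trans[OF norm_triangle_ineq4 add_mono]) (auto simp: norm_mult intro: mult_right_mono)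
        \<comment> \<open>The term with \<open>S'\<close> contributes \<open>H\<close>, the term
          with \<open>S\<close> contributes \<open>H * M\<close>; each is at most
          \<open>\<eta> * M ^ Suc k\<close>.\<close>
        have "norm ((w - p) * (deriv ^^ Suc k) f z) \<le> H * (norm (c p) + norm (c w)) + H * (M * (norm (c p) + norm (c w)))"
          unfolding eqSk[OF p w] using boundS[OF zz] boundS' diff_c[of w] ac H0
          by (intro order.trans[OF norm_triangle_ineq add_mono]) (auto simp only: norm_mult intro!: mult_mono norm_ge_zero)
        also have "\<dots> = (H + H * M) * (norm (c p) + norm (c w))"
          by (simp add: algebra_simps)
        also have "\<dots> \<le> 2 * \<eta> * M ^ Suc k * (norm (c p) + norm (c w))"
        proof (rule mult_right_mono)
          have "H * M \<le> \<eta> * M ^ k * M"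
            using HMk M by (intro mult_right_mono) auto
          moreover have "H \<le> H * M"
            using H0 M by (simp add: mult_le_cancel_left1)
          ultimately show "H + H * M \<le> 2 * \<eta> * M ^ Suc k"
            by (simp add: algebra_simps)
        qed auto
        finally show "norm ((w - p) * (deriv ^^ Suc k) f z) \<le> 2 * \<eta> * M ^ Suc k * (norm (c p) + norm (c w))" .
      qed auto
    next
      have "(\<Sum>w\<in>W. a w / M) = s z / M"
        using sum[OF zA] by (simp add: sum_divide_distrib[symmetric] a_def)
      then have "norm (\<Sum>w\<in>W. a w / M) \<le> \<eta>"
        using order.trans[OF bounds[OF zz] \<open>H \<le> \<eta> * M\<close>] M
        by (simp add: norm_divide pos_divide_le_eq)
      then show "norm (\<Sum>w\<in>W. a w / M) \<le> \<epsilon>"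
        using \<eta> by linarith
    qed (fact mk d \<epsilon> p)+
  qed
  with C'0 show ?thesis
    using that by blast
qed

subsection \<open>Growth at infinity\<close>

definition poly_bounded :: "(complex \<Rightarrow> complex) \<Rightarrow> bool" where
  "poly_bounded a \<longleftrightarrow> (\<exists>C\<ge>0. \<exists>N r. \<forall>z. norm z > r \<longrightarrow> norm (a z) \<le> C * norm z ^ N)"

lemma poly_boundedI:
  assumes "C \<ge> 0" "\<And>z. norm z > r \<Longrightarrow> norm (a z) \<le> C * norm z ^ N"
  shows "poly_bounded a"
  using assms unfolding poly_bounded_def by blast

lemma poly_bounded2E:
  assumes "poly_bounded a" "poly_bounded b"
  obtains C N r where "C \<ge> 0" "r \<ge> 1"
    "\<And>z. norm z > r \<Longrightarrow> norm (a z) \<le> C * norm z ^ N"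
    "\<And>z. norm z > r \<Longrightarrow> norm (b z) \<le> C * norm z ^ N"
proof -
  obtain C1 N1 r1 where 1: "C1 \<ge> 0" "\<And>z. norm z > r1 \<Longrightarrow> norm (a z) \<le> C1 * norm z ^ N1"
    using assms(1) unfolding poly_bounded_def by blast
  obtain C2 N2 r2 where 2: "C2 \<ge> 0" "\<And>z. norm z > r2 \<Longrightarrow> norm (b z) \<le> C2 * norm z ^ N2"
    using assms(2) unfolding poly_bounded_def by blast
  show ?thesis
  proof (rule that[of "C1 + C2" "Max {1, r1, r2}" "N1 + N2"])
    fix z :: complex assume "norm z > Max {1, r1, r2}"
    then have z: "norm z \<ge> 1" "norm z > r1" "norm z > r2"
      by auto
    have "C1 * norm z ^ N1 \<le> (C1 + C2) * norm z ^ (N1 + N2)"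
      using z 1(1) 2(1) by (intro mult_mono power_increasing) auto
    then show "norm (a z) \<le> (C1 + C2) * norm z ^ (N1 + N2)"
      using 1(2)[OF z(2)] by linarith
    have "C2 * norm z ^ N2 \<le> (C1 + C2) * norm z ^ (N1 + N2)"
      using z 1(1) 2(1) by (intro mult_mono power_increasing) auto
    then show "norm (b z) \<le> (C1 + C2) * norm z ^ (N1 + N2)"
      using 2(2)[OF z(3)] by linarith
  qed (use 1 2 in auto)
qed

lemma poly_bounded_add:
  assumes "poly_bounded a" "poly_bounded b"
  shows "poly_bounded (\<lambda>z. a z + b z)"
proof -
  obtain C N r where *: "C \<ge> 0" "\<And>z. norm z > r \<Longrightarrow> norm (a z) \<le> C * norm z ^ N"
    "\<And>z. norm z > r \<Longrightarrow> norm (b z) \<le> C * norm z ^ N"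
    using poly_bounded2E[OF assms] by metis
  show ?thesis
  proof (rule poly_boundedI)
    show "norm (a z + b z) \<le> (2 * C) * norm z ^ N" if "norm z > r" for z
      using norm_triangle_ineq[of "a z" "b z"] *(2,3)[OF that] by simp
  qed (use * in auto)
qed

lemma poly_bounded_uminus: "poly_bounded (\<lambda>z. - a z) \<longleftrightarrow> poly_bounded a"
  by (simp add: poly_bounded_def)

lemma poly_eventually_ge:
  fixes q :: "complex poly"
  assumes "q \<noteq> 0"
  obtains c r where "c > 0" "\<And>z. norm z > r \<Longrightarrow> norm (poly q z) \<ge> c"
proof (cases q)
  case (pCons a p)
  show ?thesis
  proof (cases "p = 0")
    case True
    then show ?thesis
      using pCons assms by (intro that[of "norm a" 0]) auto
  next
    case False
    then obtain r where "\<forall>z. r \<le> norm z \<longrightarrow> 1 \<le> norm (poly (pCons a p) z)"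
      using poly_infinity[of p 1 a] by blast
    then show ?thesis
      using pCons by (intro that[of 1 r]) auto
  qed
qed

lemma poly_bounded_rational:
  fixes p q :: "complex poly"
  assumes "q \<noteq> 0"
  shows "poly_bounded (\<lambda>z. poly p z / poly q z)"
proof -
  obtain c r where cr: "c > 0" "\<And>z. norm z > r \<Longrightarrow> norm (poly q z) \<ge> c"
    using poly_eventually_ge[OF assms] by metis
  define C where "C = (\<Sum>i\<le>degree p. norm (coeff p i))"
  have C: "C \<ge> 0"
    unfolding C_def by (intro sum_nonneg) auto
  show ?thesis
  proof (rule poly_boundedI)
    fix z :: complex assume "norm z > max 1 r"
    then have z: "norm z \<ge> 1" "norm z > r"
      by auto
    have "norm (poly p z) \<le> (\<Sum>i\<le>degree p. norm (coeff p i * z ^ i))"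
      unfolding poly_altdef by (rule norm_sum)
    also have "\<dots> \<le> (\<Sum>i\<le>degree p. norm (coeff p i) * norm z ^ degree p)"
      using z by (intro sum_mono) (auto simp: norm_mult norm_power intro!: mult_left_mono power_increasing)
    also have "\<dots> = C * norm z ^ degree p"
      by (simp add: C_def sum_distrib_right)
    finally have "norm (poly p z) / norm (poly q z) \<le> C * norm z ^ degree p / c"
      using cr z C by (intro frac_le) auto
    then show "norm (poly p z / poly q z) \<le> C / c * norm z ^ degree p"
      by (simp add: norm_divide)
  qed (use C cr in auto)
qed

text \<open>The logarithmic derivative is integrated along the ray through \<open>z\<close>,
  starting on the circle of radius \<open>r + 1\<close>, where compactness bounds \<open>u\<close>.
  The path has length at most \<open>norm z\<close>, which raises the exponent by one.\<close>

lemma exp_growth_of_log_deriv_growth: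
  fixes u \<phi> :: "complex \<Rightarrow> complex"
  assumes hol: "u holomorphic_on {z. r < norm z}" and r: "r \<ge> 0" and C: "C \<ge> 0"
    and du: "\<And>z. norm z > r \<Longrightarrow> deriv u z = \<phi> z * u z"
    and bound: "\<And>z. norm z > r \<Longrightarrow> norm (\<phi> z) \<le> C * norm z ^ N"
  obtains D where "D \<ge> 0" "\<And>z. norm z > r + 1 \<Longrightarrow> norm (u z) \<le> D * exp (C * norm z ^ Suc N)"
proof -
  have "open {z::complex. r < norm z}"
    by (intro open_Collect_less continuous_intros)
  have "compact (u ` sphere 0 (r + 1))"
    using r by (intro compact_continuous_image continuous_on_subset[OF holomorphic_on_imp_continuous_on[OF hol]]) auto
  then obtain D where D: "\<And>z. z \<in> sphere 0 (r + 1) \<Longrightarrow> norm (u z) \<le> D"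
    by (meson compact_imp_bounded bounded_iff imageI)
  have "complex_of_real (r + 1) \<in> sphere 0 (r + 1)"
    using r by (simp del: of_real_add)
  then have D0: "D \<ge> 0"
    using D norm_ge_zero order.trans by blast
  show ?thesis
  proof (rule that[OF D0])
    fix z :: complex assume z: "norm z > r + 1"
    define \<rho> where "\<rho> = (r + 1) / norm z"
    have z0: "norm z > 0"
      using z r by linarith
    have \<rho>: "0 \<le> \<rho>" "\<rho> \<le> 1" "\<rho> * norm z = r + 1"
      using z r z0 by (auto simp: \<rho>_def)
    define w where "w = of_real \<rho> * z"
    have w: "norm w = r + 1"
      using \<rho> by (simp add: w_def norm_mult)
    have dist: "dist w z \<le> norm z"
    proof -
      have "w - z = of_real (\<rho> - 1) * z"
        by (simp add: w_def algebra_simps)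
      then have "dist w z = \<bar>\<rho> - 1\<bar> * norm z"
        by (simp only: dist_norm norm_mult norm_of_real)
      also have "\<dots> \<le> 1 * norm z"
        using \<rho> by (intro mult_right_mono) auto
      finally show ?thesis by simp
    qed
    have seg: "r < norm x \<and> norm x \<le> norm z" if x: "x \<in> closed_segment w z" for x
    proof -
      obtain t where t: "0 \<le> t" "t \<le> 1" "x = (1 - t) *\<^sub>R w + t *\<^sub>R z"
        using x unfolding closed_segment_def by blast
      define s where "s = \<rho> + t * (1 - \<rho>)"
      have "x = of_real s * z"
        unfolding t(3) by (simp add: w_def s_def scaleR_conv_of_real algebra_simps)
      moreover have s: "\<rho> \<le> s" "s \<le> 1"
        using t \<rho> mult_left_le_one_le[of "1 - \<rho>" t] by (auto simp: s_def)
      ultimately have "norm x = s * norm z"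
        using \<rho> by (simp add: norm_mult)
      then show ?thesis
        using mult_right_mono[OF s(1), of "norm z"] mult_right_mono[OF s(2), of "norm z"] \<rho>(3) by simp
    qed
    have "norm (u z) \<le> norm (u w) * exp ((C * norm z ^ N) * dist w z)"
    proof (rule norm_le_exp_of_log_deriv_bound)
      fix x assume x: "x \<in> closed_segment w z"
      then show "(u has_field_derivative \<phi> x * u x) (at x)"
        using seg[OF x] holomorphic_derivI[OF hol \<open>open _\<close>, of x] by (simp add: du)
      have "C * norm x ^ N \<le> C * norm z ^ N"
        using seg[OF x] C by (intro mult_left_mono power_mono) auto
      then show "norm (\<phi> x) \<le> C * norm z ^ N"
        using bound[of x] seg[OF x] by linarith
    qed
    also have "\<dots> \<le> D * exp ((C * norm z ^ N) * norm z)"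
      using D[of w] w D0 C dist by (intro mult_mono iffD2[OF exp_le_cancel_iff] mult_left_mono) auto
    finally show "norm (u z) \<le> D * exp (C * norm z ^ Suc N)"
      by (simp add: mult_ac)
  qed
qed

subsection \<open>Nevanlinna order\<close>

text \<open>A non-integrable \<open>g\<close> has \<open>integral\<close> 0 by default, so the bound
  covers it too, and the Nevanlinna integrals can be estimated without an integrability
  proof.\<close>

lemma abs_integral_le:
  fixes g :: "real \<Rightarrow> real"
  assumes "finite S" "B \<ge> 0" "a \<le> b" "\<And>x. x \<in> {a..b} - S \<Longrightarrow> \<bar>g x\<bar> \<le> B"
  shows "\<bar>integral {a..b} g\<bar> \<le> B * (b - a)"
proof (cases "g integrable_on {a..b}")
  case True
  then have "(g has_integral integral {a..b} g) (cbox a b)"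
    by (simp add: integrable_integral)
  from has_integral_bound_spike_finite[OF assms(2,1) this] assms(3,4) show ?thesis
    by simp
qed (use assms in \<open>simp add: not_integrable_integral\<close>)

lemma nev_m_le:
  assumes "r > 0" "X sparse_in UNIV" "L \<ge> 0"
    and bound: "\<And>z. norm z = r \<Longrightarrow> z \<notin> X \<Longrightarrow> norm (f z) \<le> exp L"
  shows "\<bar>nev_m f r\<bar> \<le> L"
proof -
  define h where "h \<theta> = complex_of_real r * exp (\<i> * complex_of_real \<theta>)" for \<theta> :: real
  have "inj_on h {0..<2*pi}"
  proof (rule inj_onI)
    fix x y assume xy: "x \<in> {0..<2*pi}" "y \<in> {0..<2*pi}" "h x = h y"
    then have "exp (\<i> * complex_of_real x) = exp (\<i> * complex_of_real y)"
      using assms(1) by (simp add: h_def)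
    then have "\<i> * complex_of_real x = \<i> * complex_of_real y"
      by (rule exp_complex_eqI[rotated]) (use xy in auto)
    then show "x = y" by simp
  qed
  moreover have "finite (sphere 0 r \<inter> X)"
    using assms(2) by (intro sparse_in_compact_finite[of X UNIV, THEN finite_subset[rotated]] sparse_in_compact_finite)
      (auto intro: sparse_in_subset)
  ultimately have "finite (h -` (sphere 0 r \<inter> X) \<inter> {0..<2*pi})"
    by (intro finite_vimage_IntI)
  \<comment> \<open>The circle is parametrized injectively only on the half-open interval, so the
    endpoint \<open>2*pi\<close> is added to the exceptional angles.\<close>
  then have fin: "finite (insert (2*pi) (h -` (sphere 0 r \<inter> X) \<inter> {0..<2*pi}))"
    by simp
  have "\<bar>integral {0..2*pi} (\<lambda>\<theta>. log_plus (norm (f (h \<theta>))))\<bar> \<le> L * (2*pi - 0)"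
  proof (rule abs_integral_le[OF fin \<open>L \<ge> 0\<close>])
    fix \<theta> assume \<theta>: "\<theta> \<in> {0..2*pi} - insert (2*pi) (h -` (sphere 0 r \<inter> X) \<inter> {0..<2*pi})"
    have "norm (h \<theta>) = r"
      using assms(1) by (simp add: h_def norm_mult)
    then have "norm (f (h \<theta>)) \<le> exp L"
      using \<theta> by (intro bound) auto
    then have "ln (norm (f (h \<theta>))) \<le> L" if "norm (f (h \<theta>)) > 1"
      using ln_mono[of "norm (f (h \<theta>))" "exp L"] less_trans[OF zero_less_one that] by simp
    then show "\<bar>log_plus (norm (f (h \<theta>)))\<bar> \<le> L"
      using \<open>L \<ge> 0\<close> by (auto simp: log_plus_def not_le)
  qed auto
  then show ?thesis
    by (simp add: nev_m_def h_def abs_mult field_simps)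
qed

text \<open>The poles are finite in number, with total multiplicity \<open>n\<close>. The integrand
  vanishes below a radius \<open>\<delta>\<close> smaller than or equal to the modulus of every
  nonzero pole, and is at most \<open>n / \<delta>\<close> beyond it; \<open>ln r \<le> r\<close>
  covers the last term.\<close>

lemma nev_N_le:
  assumes "f meromorphic_on UNIV" and no_pole: "\<And>z. norm z > r0 \<Longrightarrow> \<not> is_pole f z"
  obtains K where "K \<ge> 0" "\<And>r. r \<ge> 1 \<Longrightarrow> \<bar>nev_N f r\<bar> \<le> K * r"
proof -
  define P where "P = {z. is_pole f z}"
  define n where "n = (\<Sum>z\<in>P. real (nat (- zorder f z)))"
  have "{z. \<not> \<not> is_pole f z} sparse_in UNIV"
    using meromorphic_on_imp_not_pole_cosparse[OF assms(1)] by (simp only: eventually_cosparse)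
  then have "finite (cball 0 r0 \<inter> P)"
    by (intro sparse_in_compact_finite) (auto simp: P_def intro: sparse_in_subset)
  moreover have "cball 0 r0 \<inter> P = P"
    using no_pole by (force simp: P_def not_le[symmetric])
  ultimately have fin: "finite P"
    by simp
  have n: "0 \<le> pole_count f t" "pole_count f t \<le> n" for t
    unfolding pole_count_def n_def using fin
    by (auto intro!: sum_nonneg sum_mono2 simp: P_def)
  have "n \<ge> 0"
    using n[of 0] by linarith
  obtain \<delta> where \<delta>: "\<delta> > 0" "\<And>z. z \<in> P \<Longrightarrow> z \<noteq> 0 \<Longrightarrow> \<delta> \<le> dist 0 z"
    using finite_set_avoid[OF fin, of 0] by metis
  have near0: "pole_count f t = pole_count f 0" if "0 \<le> t" "t < \<delta>" for t
  proof -
    have "{z. norm z \<le> t \<and> is_pole f z} = {z. norm z \<le> 0 \<and> is_pole f z}"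
      using that \<delta>(2) by (force simp: P_def)
    then show ?thesis
      by (simp add: pole_count_def)
  qed
  show ?thesis
  proof (rule that[of "n / \<delta> + n"])
    fix r :: real assume r: "r \<ge> 1"
    have "\<bar>integral {0..r} (\<lambda>t. (pole_count f t - pole_count f 0) / t)\<bar> \<le> n / \<delta> * (r - 0)"
    proof (rule abs_integral_le[of "{}"])
      fix t assume t: "t \<in> {0..r} - {}"
      show "\<bar>(pole_count f t - pole_count f 0) / t\<bar> \<le> n / \<delta>"
      proof (cases "t < \<delta>")
        case True
        then show ?thesis
          using near0[of t] t \<delta> \<open>n \<ge> 0\<close> by simp
      next
        case False
        then have "\<bar>pole_count f t - pole_count f 0\<bar> / \<bar>t\<bar> \<le> n / \<delta>"
          using n[of t] n[of 0] \<delta> by (intro frac_le) auto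
        then show ?thesis
          by simp
      qed
    qed (use r \<delta> \<open>n \<ge> 0\<close> in auto)
    moreover have "\<bar>pole_count f 0 * ln r\<bar> \<le> n * r"
      unfolding abs_mult using n[of 0] r ln_bound[of r] by (intro mult_mono) auto
    ultimately show "\<bar>nev_N f r\<bar> \<le> (n / \<delta> + n) * r"
      unfolding nev_N_def by (simp add: distrib_right)
  qed (use \<delta> \<open>n \<ge> 0\<close> in auto)
qed

lemma mero_order_less_infinity:
  assumes "f meromorphic_on UNIV" "X sparse_in UNIV" "L \<ge> 0"
    and no_pole: "\<And>z. norm z > r0 \<Longrightarrow> \<not> is_pole f z"
    and bound: "\<And>z. norm z > r0 \<Longrightarrow> z \<notin> X \<Longrightarrow> norm (f z) \<le> exp (L * norm z ^ N)"
  shows "mero_order f < \<infinity>"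
proof -
  obtain K where K: "K \<ge> 0" "\<And>r. r \<ge> 1 \<Longrightarrow> \<bar>nev_N f r\<bar> \<le> K * r"
    using nev_N_le[OF assms(1) no_pole] by metis
  have "mero_order f \<le> ereal (N + 2)"
    unfolding mero_order_def
  proof (rule Limsup_bounded)
    show "\<forall>\<^sub>F r in at_top. ereal (ln (nev_T f r) / ln r) \<le> ereal (N + 2)"
      \<comment> \<open>The condition \<open>r > L + K\<close> absorbs both constants into one
        further power of \<open>r\<close>.\<close>
      using eventually_gt_at_top[of "Max {2, r0, L + K}"]
    proof eventually_elim
      case (elim r)
      then have r: "r > 2" "r > r0" "r > L + K"
        by auto
      have "\<bar>nev_m f r\<bar> \<le> L * r ^ N"
        using r assms(3) by (intro nev_m_le[OF _ assms(2)] bound[THEN order.trans]) auto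
      then have "\<bar>nev_T f r\<bar> \<le> L * r ^ N + K * r"
        using K(2)[of r] r unfolding nev_T_def by linarith
      also have "\<dots> \<le> L * r ^ Suc N + K * r ^ Suc N"
        using r K assms(3) power_increasing[of 1 "Suc N" r]
        by (intro add_mono mult_left_mono power_increasing) auto
      also have "\<dots> = (L + K) * r ^ Suc N"
        by (simp add: algebra_simps)
      also have "\<dots> \<le> r * r ^ Suc N"
        using r by (intro mult_right_mono) auto
      finally have T: "\<bar>nev_T f r\<bar> \<le> r ^ (N + 2)"
        by simp
      \<comment> \<open>Real \<open>ln\<close> is even and \<open>ln 0 = 0\<close>, so the bound on
        the absolute value suffices.\<close>
      have "ln (nev_T f r) \<le> ln (r ^ (N + 2))"
      proof (cases "nev_T f r = 0")
        case True
        then show ?thesis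
          using r one_le_power[of r "N + 2"] by simp
      next
        case False
        have "ln (nev_T f r) = ln \<bar>nev_T f r\<bar>"
          by (simp add: abs_if ln_minus)
        also have "\<dots> \<le> ln (r ^ (N + 2))"
          using False T r by (subst ln_le_cancel_iff) auto
        finally show ?thesis .
      qed
      also have "\<dots> = (N + 2) * ln r"
        using r by (subst ln_realpow) auto
      finally show ?case
        using r by (simp add: pos_divide_le_eq)
    qed
  qed
  also have "\<dots> < \<infinity>"
    by simp
  finally show ?thesis .
qed

subsection \<open>The differential equation\<close>

lemma higher_deriv_pole:
  fixes f :: "complex \<Rightarrow> complex"
  assumes "f meromorphic_on {z}" "is_pole f z"
  shows "is_pole ((deriv ^^ j) f) z"
proof (induction j)
  case (Suc j)
  have "(deriv ^^ j) f meromorphic_on {z}"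
    using assms(1) by (rule meromorphic_on_higher_deriv)
  then show ?case
    using Suc by (auto intro: is_pole_deriv simp: meromorphic_at_iff)
qed (use assms in auto)

text \<open>With \<open>g = f^(j)\<close>, the quotient \<open>f^(j+1) / f\<close> is
  \<open>(g' / g) * (g / f)\<close>, and both factors tend to infinity at the pole.\<close>

lemma higher_deriv_divide_at_pole:
  fixes f :: "complex \<Rightarrow> complex"
  assumes f: "f meromorphic_on {z}" "is_pole f z" and "k \<ge> 1"
  shows "filterlim (\<lambda>x. (deriv ^^ k) f x / f x) at_infinity (at z)"
  using \<open>k \<ge> 1\<close>
proof (induction k rule: dec_induct)
  case base
  show ?case
    using is_pole_deriv_divide_is_pole[of f z] f by (simp add: meromorphic_at_iff is_pole_def)
next
  case (step j)
  define g where "g = (deriv ^^ j) f"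
  have g: "g meromorphic_on {z}" "is_pole g z"
    unfolding g_def using f meromorphic_on_higher_deriv higher_deriv_pole by blast+
  have "filterlim (\<lambda>x. deriv g x / g x) at_infinity (at z)"
    using is_pole_deriv_divide_is_pole[of g z] g by (simp add: meromorphic_at_iff is_pole_def)
  then have "filterlim (\<lambda>x. (deriv g x / g x) * (g x / f x)) at_infinity (at z)"
    using step.IH unfolding g_def by (rule filterlim_at_infinity_times)
  moreover have "\<forall>\<^sub>F x in at z. g x \<noteq> 0"
    using g(2) by (rule non_zero_neighbour_pole)
  then have "\<forall>\<^sub>F x in at z. (deriv g x / g x) * (g x / f x) = (deriv ^^ Suc j) f x / f x"
    by eventually_elim (simp add: g_def)
  ultimately show ?case
    by (subst (asm) filterlim_cong[OF refl refl]) auto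
qed

text \<open>With \<open>q = f^(k) / f\<close> the left side is \<open>f^m (1 + (R q)^m)\<close>. At
  a pole both factors tend to infinity, whereas \<open>G\<close> stays bounded near
  \<open>z\<close>.\<close>

lemma no_pole_of_fermat_type_equation:
  fixes f R G :: "complex \<Rightarrow> complex"
  assumes f: "f meromorphic_on {z}" and R: "isCont R z" "R z \<noteq> 0" and G: "isCont G z"
    and mk: "m \<ge> 1" "k \<ge> 1"
    and eq: "\<forall>\<^sub>F x in at z. f x ^ m + (R x * (deriv ^^ k) f x) ^ m = G x"
  shows "\<not> is_pole f z"
proof
  assume pole: "is_pole f z"
  define q where "q x = (deriv ^^ k) f x / f x" for x
  have flim: "filterlim f at_infinity (at z)"
    using pole by (simp add: is_pole_def)
  have "filterlim q at_infinity (at z)"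
    unfolding q_def using higher_deriv_divide_at_pole[OF f pole mk(2)] .
  then have "filterlim (\<lambda>x. R x * q x) at_infinity (at z)"
    using R by (intro tendsto_mult_filterlim_at_infinity) (auto simp: isCont_def)
  then have "filterlim (\<lambda>x. (R x * q x) ^ m) at_infinity (at z)"
    by (rule Limits.filterlim_power_at_infinity) (use mk in auto)
  then have "filterlim (\<lambda>x. 1 + (R x * q x) ^ m) at_infinity (at z)"
    by (rule tendsto_add_filterlim_at_infinity[OF tendsto_const])
  moreover have "filterlim (\<lambda>x. f x ^ m) at_infinity (at z)"
    using flim by (rule Limits.filterlim_power_at_infinity) (use mk in auto)
  ultimately have lim: "filterlim (\<lambda>x. f x ^ m * (1 + (R x * q x) ^ m)) at_infinity (at z)"
    by (intro filterlim_at_infinity_times)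
  have "\<forall>\<^sub>F x in at z. f x \<noteq> 0"
    using pole by (rule non_zero_neighbour_pole)
  with eq have "\<forall>\<^sub>F x in at z. f x ^ m * (1 + (R x * q x) ^ m) = G x"
  proof eventually_elim
    case (elim x)
    have "f x ^ m * (1 + (R x * q x) ^ m) = f x ^ m + (f x * (R x * q x)) ^ m"
      by (simp add: algebra_simps power_mult_distrib)
    also have "f x * (R x * q x) = R x * (deriv ^^ k) f x"
      using elim by (simp add: q_def)
    finally show ?case
      using elim by simp
  qed
  then have "filterlim G at_infinity (at z)"
    using lim by (subst (asm) filterlim_cong[OF refl refl]) auto
  then show False
    using G not_tendsto_and_filterlim_at_infinity[of "at z" G "G z"] by (auto simp: isCont_def)
qed


lemma fermat_type_equation_mero_order:
  fixes Q R f :: "complex \<Rightarrow> complex" and \<alpha> :: "complex poly" and k m :: nat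
  assumes Q: "rational_function Q" "Q \<noteq> (\<lambda>_. 0)"
    and R: "rational_function R" "R \<noteq> (\<lambda>_. 0)"
    and mk: "m \<ge> 2" "k \<ge> 1"
    and f: "f meromorphic_on UNIV"
    and eq: "\<forall>\<^sub>\<approx>z. f z ^ m + (R z * (deriv ^^ k) f z) ^ m = Q z * exp (poly \<alpha> z)"
  shows "mero_order f < \<infinity>"
proof -
  obtain Qn Qd where Q': "Qd \<noteq> 0" "Q = (\<lambda>z. poly Qn z / poly Qd z)"
    using Q(1) unfolding rational_function_def by blast
  obtain Rn Rd where R': "Rd \<noteq> 0" "R = (\<lambda>z. poly Rn z / poly Rd z)"
    using R(1) unfolding rational_function_def by blast
  have nz: "Qn \<noteq> 0" "Rn \<noteq> 0"
    using Q(2) R(2) Q'(2) R'(2) by auto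
  \<comment> \<open>A lower bound for this one product outside a disc excludes zeros of all four
    polynomials there.\<close>
  define T where "T = Qn * Qd * (Rn * Rd)"
  have "T \<noteq> 0"
    using nz Q'(1) R'(1) by (simp add: T_def)
  then obtain c r1 where r1: "c > 0" "\<And>z. norm z > r1 \<Longrightarrow> norm (poly T z) \<ge> c"
    using poly_eventually_ge by blast
  have polys: "poly Qn z \<noteq> 0" "poly Qd z \<noteq> 0" "poly Rn z \<noteq> 0" "poly Rd z \<noteq> 0" if "norm z > r1" for z
    using r1(2)[OF that] r1(1) by (auto simp: T_def)
  define S where "S z = poly Rd z / poly Rn z" for z
  \<comment> \<open>The logarithmic derivative of \<open>Q e^\<alpha>\<close>, with every summand a
    quotient of polynomials so that \<open>poly_bounded_rational\<close> applies.\<close>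
  define s where "s z = poly (pderiv Qn) z / poly Qn z + - (poly (pderiv Qd) z / poly Qd z) + poly (pderiv \<alpha>) z / poly 1 z" for z
  define G where "G z = Q z * exp (poly \<alpha> z)" for z
  have "poly_bounded S" "poly_bounded s"
    unfolding S_def s_def poly_bounded_uminus using nz Q'(1)
    by (intro poly_bounded_add poly_bounded_rational iffD2[OF poly_bounded_uminus]; simp)+
  then obtain C N r2 where C: "C \<ge> 0" "r2 \<ge> 1"
    and S: "\<And>z. norm z > r2 \<Longrightarrow> norm (S z) \<le> C * norm z ^ N"
    and s: "\<And>z. norm z > r2 \<Longrightarrow> norm (s z) \<le> C * norm z ^ N"
    using poly_bounded2E by metis
  define r0 where "r0 = max r1 r2"
  define A where "A = {z::complex. r0 < norm z}"
  have r0: "r0 \<ge> 1" and A1: "\<And>z. z \<in> A \<Longrightarrow> norm z > r1" and A2: "\<And>z. z \<in> A \<Longrightarrow> norm z > r2"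
    using C by (auto simp: r0_def A_def)
  have "open A"
    unfolding A_def by (intro open_Collect_less continuous_intros)
  have dG: "(G has_field_derivative G z * s z) (at z)" if "z \<in> A" for z
  proof -
    note [simp] = polys[OF A1[OF that]]
    show ?thesis
      unfolding G_def Q'(2) s_def
      by (auto intro!: derivative_eq_intros poly_DERIV simp: field_simps)
  qed
  have G0: "G z \<noteq> 0" if "z \<in> A" for z
    using polys[OF A1[OF that]] by (simp add: G_def Q'(2))
  have holS: "S holomorphic_on A"
    unfolding S_def using polys[OF A1] by (intro holomorphic_intros) auto
  have holR: "R holomorphic_on A"
    unfolding R'(2) using polys[OF A1] by (intro holomorphic_intros) auto

  \<comment> \<open>Removal of singularities and holomorphy near infinity\<close>
  define F where "F = remove_sings f"
  have F: "F nicely_meromorphic_on UNIV"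
    unfolding F_def using f by (rule remove_sings_nicely_meromorphic)
  have Feq: "\<forall>\<^sub>\<approx>z. F z = f z"
    unfolding F_def using f by (rule eventually_remove_sings_eq)
  \<comment> \<open>At the points where \<open>f\<close> is analytic, which form a cosparse set,
    \<open>F\<close> and \<open>f\<close> agree on a neighbourhood and so have the same
    derivatives.\<close>
  have eqF: "\<forall>\<^sub>\<approx>z. F z ^ m + (R z * (deriv ^^ k) F z) ^ m = G z"
    using eq meromorphic_on_imp_analytic_cosparse[OF f] unfolding G_def
  proof eventually_elim
    case (elim z)
    then have ev: "\<forall>\<^sub>F x in nhds z. F x = f x"
      unfolding F_def using eventually_remove_sings_eq_nhds by blast
    have "(deriv ^^ k) F z = (deriv ^^ k) f z"
      using ev by (intro higher_deriv_cong_ev) auto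
    then show ?case
      using elim eventually_nhds_x_imp_x[OF ev] by simp
  qed
  have eqF_at: "\<forall>\<^sub>F x in at z. F x ^ m + (R x * (deriv ^^ k) F x) ^ m = G x" for z
    using eqF by (rule eventually_cosparse_imp_eventually_at) auto
  have no_pole: "\<not> is_pole F z" if "z \<in> A" for z
  proof (rule no_pole_of_fermat_type_equation[OF _ _ _ _ _ _ eqF_at])
    show "F meromorphic_on {z}"
      using F by (auto simp: nicely_meromorphic_on_def intro: meromorphic_on_subset)
    show "isCont R z"
      using holR \<open>open A\<close> that by (meson continuous_on_eq_continuous_at holomorphic_on_imp_continuous_on)
    show "R z \<noteq> 0"
      using polys[OF A1[OF that]] by (simp add: R'(2))
    show "isCont G z"
      using dG[OF that] by (rule DERIV_isCont)
  qed (use mk in auto)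
  have "F analytic_on {z}" if "z \<in> A" for z
    using nicely_meromorphic_on_imp_analytic_at[OF F _ no_pole[OF that]] by simp
  then have holF: "F holomorphic_on A"
    by (meson analytic_imp_holomorphic analytic_on_analytic_at)
  define h where "h z = R z * (deriv ^^ k) F z" for z
  have holh: "h holomorphic_on A"
    unfolding h_def using holR holF \<open>open A\<close> by (intro holomorphic_intros holomorphic_higher_deriv)
  \<comment> \<open>By continuity the equation passes from punctured neighbourhoods to every point
    of \<open>A\<close>.\<close>
  have eqA: "F z ^ m + h z ^ m = G z" if "z \<in> A" for z
  proof -
    have cont: "isCont F z" "isCont h z"
      using holF holh \<open>open A\<close> that by (meson continuous_on_eq_continuous_at holomorphic_on_imp_continuous_on)+
    have "((\<lambda>x. F x ^ m + h x ^ m) \<longlongrightarrow> F z ^ m + h z ^ m) (at z)"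
      using cont unfolding isCont_def by (intro tendsto_intros)
    then have "(G \<longlongrightarrow> F z ^ m + h z ^ m) (at z)"
      using eqF_at[of z] by (subst (asm) tendsto_cong) (auto simp: h_def)
    moreover have "(G \<longlongrightarrow> G z) (at z)"
      using DERIV_isCont[OF dG[OF that]] by (simp add: isCont_def)
    ultimately show ?thesis
      by (rule tendsto_unique[OF at_neq_bot])
  qed

  \<comment> \<open>Factorization over the roots of -1\<close>
  define W where "W = {w::complex. w ^ m = -1}"
  have fin: "finite W" and card: "card W = m"
    using mk by (auto simp: W_def card_nth_roots intro: finite_nth_roots)
  have prod: "(\<Prod>w\<in>W. F z - w * h z) = G z" if "z \<in> A" for z
    using power_add_power_eq_prod[of m "F z" "h z"] eqA[OF that] mk by (simp add: W_def)
  have u0: "F z - w * h z \<noteq> 0" if "z \<in> A" "w \<in> W" for z w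
    using prod[OF that(1)] G0[OF that(1)] fin that(2) by (metis prod_zero)
  define \<phi> where "\<phi> w z = (deriv F z - w * deriv h z) / (F z - w * h z)" for w z
  have du: "((\<lambda>z. F z - w * h z) has_field_derivative deriv F z - w * deriv h z) (at z)" if "z \<in> A" for w z
    using holomorphic_derivI[OF holF \<open>open A\<close> that] holomorphic_derivI[OF holh \<open>open A\<close> that]
    by (auto intro!: derivative_eq_intros)
  \<comment> \<open>The product of the factors is \<open>G\<close>, so its logarithmic derivative is
    computed in two ways.\<close>
  have sum: "(\<Sum>w\<in>W. \<phi> w z) = s z" if "z \<in> A" for z
  proof -
    have "((\<lambda>z. \<Prod>w\<in>W. F z - w * h z) has_field_derivative (\<Prod>w\<in>W. F z - w * h z) * (\<Sum>w\<in>W. \<phi> w z)) (at z)"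
      unfolding \<phi>_def using u0 du that by (intro has_field_derivative_prod') auto
    then have "(G has_field_derivative G z * (\<Sum>w\<in>W. \<phi> w z)) (at z)"
      using prod that
      by (subst (asm) prod[OF that]) (rule has_field_derivative_transform_within_open[OF _ \<open>open A\<close> that])
    then show ?thesis
      using DERIV_unique[OF _ dG[OF that]] G0[OF that] by (metis mult_left_cancel)
  qed
  obtain C' where C': "C' \<ge> 0"
    "\<And>z w. norm z > r0 + 2 \<Longrightarrow> w \<in> W \<Longrightarrow> norm (\<phi> w z) \<le> C' * norm z ^ N"
  proof (rule log_deriv_polynomial_growth[of m k r0 C F h S s N, folded A_def W_def \<phi>_def])
    show "(deriv ^^ k) F z = S z * h z" if "z \<in> A" for z
      using polys[OF A1[OF that]] by (simp add: S_def h_def R'(2))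
  qed (use mk r0 C holF holh holS u0 sum S s A2 in auto)

  \<comment> \<open>Growth of the solution\<close>
  obtain p where p: "p \<in> W"
    using card mk by fastforce
  have "card (W - {p}) \<noteq> 0"
    using fin card p mk by simp
  then have "W - {p} \<noteq> {}"
    by force
  then obtain q where q: "q \<in> W" "q \<noteq> p"
    by blast
  have growth: "\<exists>D\<ge>0. \<forall>z. norm z > r0 + 3 \<longrightarrow> norm (F z - w * h z) \<le> D * exp (C' * norm z ^ Suc N)" if w: "w \<in> W" for w
  proof -
    have sub: "{z. r0 + 2 < norm z} \<subseteq> A"
      by (auto simp: A_def)
    obtain D where "D \<ge> 0" "\<And>z. norm z > (r0 + 2) + 1 \<Longrightarrow> norm (F z - w * h z) \<le> D * exp (C' * norm z ^ Suc N)"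
    proof (rule exp_growth_of_log_deriv_growth[of "\<lambda>z. F z - w * h z" "r0 + 2" C' "\<phi> w" N])
      show "(\<lambda>z. F z - w * h z) holomorphic_on {z. r0 + 2 < norm z}"
        using holF holh sub by (intro holomorphic_intros) (auto intro: holomorphic_on_subset)
      show "deriv (\<lambda>z. F z - w * h z) z = \<phi> w z * (F z - w * h z)" if "norm z > r0 + 2" for z
        using that sub u0[OF _ w] DERIV_imp_deriv[OF du, of z w] by (auto simp: \<phi>_def)
    qed (use r0 C' w in auto)
    then show ?thesis
      by (intro exI[of _ D]) (simp add: add.assoc)
  qed
  obtain Dp where Dp: "Dp \<ge> 0" "\<And>z. norm z > r0 + 3 \<Longrightarrow> norm (F z - p * h z) \<le> Dp * exp (C' * norm z ^ Suc N)"
    using growth[OF p] by blast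
  obtain Dq where Dq: "Dq \<ge> 0" "\<And>z. norm z > r0 + 3 \<Longrightarrow> norm (F z - q * h z) \<le> Dq * exp (C' * norm z ^ Suc N)"
    using growth[OF q(1)] by blast
  define D where "D = (Dp + Dq) / norm (q - p)"
  have D: "D \<ge> 0"
    using Dp Dq by (simp add: D_def)
  have F_bound: "norm (F z) \<le> exp ((D + C') * norm z ^ Suc N)" if z: "norm z > r0 + 3" for z
  proof -
    have unit: "norm p = 1" "norm q = 1"
      using norm_root_minus_1[of _ m] p q mk by (auto simp: W_def)
    \<comment> \<open>Two distinct roots, available as \<open>m \<ge> 2\<close>, suffice to
      eliminate \<open>h\<close> and recover \<open>F\<close>.\<close>
    have "(q - p) * F z = q * (F z - p * h z) - p * (F z - q * h z)"
      by (simp add: algebra_simps)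
    then have "norm (q - p) * norm (F z) = norm (q * (F z - p * h z) - p * (F z - q * h z))"
      by (metis norm_mult)
    also have "\<dots> \<le> norm (F z - p * h z) + norm (F z - q * h z)"
      using norm_triangle_ineq4[of "q * (F z - p * h z)" "p * (F z - q * h z)"] unit by (simp add: norm_mult)
    also have "\<dots> \<le> (Dp + Dq) * exp (C' * norm z ^ Suc N)"
      using Dp(2)[OF z] Dq(2)[OF z] by (simp add: distrib_right)
    finally have "norm (F z) \<le> D * exp (C' * norm z ^ Suc N)"
      using q(2) by (simp add: D_def field_simps)
    \<comment> \<open>The factor \<open>D\<close> moves into the exponent by
      \<open>x \<le> exp x\<close> with \<open>x = D * norm z ^ Suc N\<close>, which is at least
      \<open>D\<close> because \<open>norm z \<ge> 1\<close>.\<close>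
    also have "\<dots> \<le> exp (D * norm z ^ Suc N) * exp (C' * norm z ^ Suc N)"
    proof (rule mult_right_mono)
      have "D * 1 \<le> D * norm z ^ Suc N"
        using D z r0 by (intro mult_left_mono one_le_power) auto
      then show "D \<le> exp (D * norm z ^ Suc N)"
        using exp_ge_add_one_self[of "D * norm z ^ Suc N"] by linarith
    qed auto
    finally show ?thesis
      by (simp add: distrib_right exp_add)
  qed
  show ?thesis
  proof (rule mero_order_less_infinity[OF f])
    show "{z. F z \<noteq> f z} sparse_in UNIV"
      using Feq by (simp add: eventually_cosparse)
    show "D + C' \<ge> 0"
      using D C' by simp
    fix z :: complex assume z: "norm z > r0 + 3"
    have "isolated_singularity_at f z" "not_essential f z"
      using f by (auto simp: meromorphic_on_altdef)
    then show "\<not> is_pole f z"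
      using no_pole[of z] z by (simp add: F_def A_def)
    show "norm (f z) \<le> exp ((D + C') * norm z ^ Suc N)" if "z \<notin> {z. F z \<noteq> f z}"
      using F_bound[OF z] that by simp
  qed
qed

theorem theorem2p2:
  fixes Q R :: "complex \<Rightarrow> complex" and \<alpha> :: "complex poly" and k m :: nat
  assumes "rational_function Q" and "Q \<noteq> (\<lambda>_. 0)"
    and "rational_function R" and "R \<noteq> (\<lambda>_. 0)"
    and "k \<ge> 1" and "m \<ge> 2"
  shows "\<not> (\<exists>f. f meromorphic_on UNIV
              \<and> (\<forall>\<^sub>\<approx>z. f z ^ m + (R z * (deriv ^^ k) f z) ^ m = Q z * exp (poly \<alpha> z))
              \<and> mero_order f = \<infinity>)"
  using fermat_type_equation_mero_order[OF assms(1-4) assms(6,5)] by fastforce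

end
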